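(* Let $V>0$ and let $\alpha>0$ be fixed. Consider on the quadrant $\{(\nu,\beta)\in\mathbb R^2:\nu,\beta>0\}$ the dynamical system $$\dot\beta=-\mathbb E\left[\tfrac{\partial K}{\partial\beta}\right],\qquad \dot\nu=-\mathbb E\left[\tfrac{\partial K}{\partial\nu}\right]\qquad(\ast)$$ with right-hand sides given in the context. For $\alpha,V>0$ define the curve $$\mathbf C_{\alpha,V}:=\left\{(\nu,\beta)\in\mathbb R^2:\ \nu>0,\ \frac{\beta(\nu+1)}{\nu}=(\alpha-A(\alpha))V\right\},$$ and consider the family of curves $$\beta^2+\nu^2+\frac{2\nu^3}{3}=C,\qquad C>0,\qquad(\ast\ast)$$ in the quadrant. Then the following hold. 1. System $(\ast)$ possesses a globally attracting family of equilibria lying on the curve $\mathbf C_{\alpha,V}$; that is, the points of $\mathbf C_{\alpha,V}$ are equilibria and every trajectory starting in the quadrant converges to $\mathbf C_{\alpha,V}$ as $t\to\infty$. 2. Each trajectory $(\nu(t),\beta(t))$ lies on one of the curves $(\ast\ast)$. If $(\nu(0),\beta(0))$ lies below the curve $\mathbf C_{\alpha,V}$, then $\nu(t)$ decreases and converges to $\nu_*$ and $\beta(t)$ increases and converges to $\beta_*$. If $(\nu(0),\beta(0))$ lies above the curve $\mathbf C_{\alpha,V}$, then $\nu(t)$ increases and converges to $\nu_*$ and $\beta(t)$ decreases and converges to $\beta_*$. In both cases, $(\nu_*,\beta_* )$ is the point of intersection of the corresponding curve $(\ast\ast)$ and the curve of equilibria $\mathbf C_{\alpha,V}$. 3. The family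 of curves $(\ast\ast)$ is orthogonal to the family of the curves of equilibria $\{\mathbf C_{\alpha,V}\}_{\alpha,V>0}$; that is, whenever a curve $(\ast\ast)$ and a curve $\mathbf C_{\alpha,V}$ intersect at a point of the quadrant, their tangent lines there are orthogonal.
   Context: The right-hand sides are, with $\sigma=\beta(\nu+1)/\nu$, $$\mathbb E\left[\tfrac{\partial K}{\partial\beta}\right]=\frac1\beta\left(\frac{\alpha+1/2}{(2\pi)^{1/2}}\int_{-\infty}^\infty\frac{1}{1+\frac V\sigma\frac{z^2}2}e^{-z^2/2}dz-\alpha\right),$$ $$\mathbb E\left[\tfrac{\partial K}{\partial\nu}\right]=\frac1{2\nu(\nu+1)}\left(\frac{2\alpha+1}{(2\pi)^{1/2}}\int_{-\infty}^\infty\frac{z^2}{\frac{2\sigma}{V}+z^2}e^{-z^2/2}dz-1\right).$$ For $x>0$ let $F(x)=\frac1{(2\pi)^{1/2}}\int_{-\infty}^\infty\frac1{2x+z^2}e^{-z^2/2}dz$. For $\alpha>0$, $A=A(\alpha)<\alpha$ is the unique root of $F(\alpha-A)=\frac{\alpha}{(2\alpha+1)(\alpha-A)}$. A point $(\nu,\beta)$ of the quadrant lies below (above) $\mathbf C_{\alpha,V}$ if $\beta<(\alpha-A(\alpha))V\frac{\nu}{\nu+1}$ (respectively $>$). The curves $(\ast\ast)$ are the integral curves of $\frac{d\beta}{d\nu}=-\frac{\nu(\nu+1)}{\beta}$. *)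

theory Defs
  imports "HOL-Analysis.Analysis"
begin

text \<open>Points of the plane are written \<open>(\<nu>, \<beta>)\<close>, in this order, as elements of \<open>real \<times> real\<close>
  with its Euclidean metric and inner product.\<close>

definition quadrant :: "(real \<times> real) set" where
  "quadrant = {(\<nu>, \<beta>). \<nu> > 0 \<and> \<beta> > 0}"

definition sigma :: "real \<Rightarrow> real \<Rightarrow> real" where
  "sigma \<nu> \<beta> = \<beta> * (\<nu> + 1) / \<nu>"

text \<open>The closed forms of the expected partial derivatives of \<open>K\<close>.\<close>

definition E_dK_dbeta :: "real \<Rightarrow> real \<Rightarrow> real \<Rightarrow> real \<Rightarrow> real" where
  "E_dK_dbeta \<alpha> V \<nu> \<beta> =
     1 / \<beta> * ((\<alpha> + 1 / 2) / sqrt (2 * pi) *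
       (LINT z|lborel. 1 / (1 + V / sigma \<nu> \<beta> * (z\<^sup>2 / 2)) * exp (- z\<^sup>2 / 2)) - \<alpha>)"

definition E_dK_dnu :: "real \<Rightarrow> real \<Rightarrow> real \<Rightarrow> real \<Rightarrow> real" where
  "E_dK_dnu \<alpha> V \<nu> \<beta> =
     1 / (2 * \<nu> * (\<nu> + 1)) * ((2 * \<alpha> + 1) / sqrt (2 * pi) *
       (LINT z|lborel. z\<^sup>2 / (2 * sigma \<nu> \<beta> / V + z\<^sup>2) * exp (- z\<^sup>2 / 2)) - 1)"

definition equilibrium :: "real \<Rightarrow> real \<Rightarrow> real \<times> real \<Rightarrow> bool" where
  "equilibrium \<alpha> V p \<longleftrightarrow>
     p \<in> quadrant \<and> E_dK_dbeta \<alpha> V (fst p) (snd p) = 0 \<and> E_dK_dnu \<alpha> V (fst p) (snd p) = 0"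

definition time_dom :: "ereal \<Rightarrow> real set" where
  "time_dom T = {t. 0 \<le> t \<and> ereal t < T}"

text \<open>A forward solution in the quadrant on \<open>[0, T)\<close>, where \<open>T\<close> may be infinite;
  the derivative at time 0 is one-sided.\<close>

definition solution :: "real \<Rightarrow> real \<Rightarrow> ereal \<Rightarrow> (real \<Rightarrow> real) \<Rightarrow> (real \<Rightarrow> real) \<Rightarrow> bool" where
  "solution \<alpha> V T \<nu> \<beta> \<longleftrightarrow> 0 < T \<and>
     (\<forall>t \<in> time_dom T.
        (\<nu> t, \<beta> t) \<in> quadrant \<and>
        (\<beta> has_real_derivative - E_dK_dbeta \<alpha> V (\<nu> t) (\<beta> t)) (at t within time_dom T) \<and>
        (\<nu> has_real_derivative - E_dK_dnu \<alpha> V (\<nu> t) (\<beta> t)) (at t within time_dom T))"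

text \<open>A trajectory is a solution that is maximal in forward time. That \<open>T = \<infinity>\<close> is not built
  into the definition. The values of \<open>\<nu>\<close> and \<open>\<beta>\<close> outside \<open>[0, T)\<close> are irrelevant.\<close>

definition trajectory :: "real \<Rightarrow> real \<Rightarrow> ereal \<Rightarrow> (real \<Rightarrow> real) \<Rightarrow> (real \<Rightarrow> real) \<Rightarrow> bool" where
  "trajectory \<alpha> V T \<nu> \<beta> \<longleftrightarrow> solution \<alpha> V T \<nu> \<beta> \<and>
     (\<forall>T' \<nu>' \<beta>'. T \<le> T' \<and> solution \<alpha> V T' \<nu>' \<beta>' \<and>
        (\<forall>t \<in> time_dom T. \<nu>' t = \<nu> t \<and> \<beta>' t = \<beta> t) \<longrightarrow> T' = T)"

definition F :: "real \<Rightarrow> real" where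
  "F x = 1 / sqrt (2 * pi) * (LINT z|lborel. 1 / (2 * x + z\<^sup>2) * exp (- z\<^sup>2 / 2))"

definition A :: "real \<Rightarrow> real" where
  "A \<alpha> = (THE a. a < \<alpha> \<and> F (\<alpha> - a) = \<alpha> / ((2 * \<alpha> + 1) * (\<alpha> - a)))"

definition eq_curve :: "real \<Rightarrow> real \<Rightarrow> (real \<times> real) set" where
  "eq_curve \<alpha> V = {(\<nu>, \<beta>). \<nu> > 0 \<and> \<beta> * (\<nu> + 1) / \<nu> = (\<alpha> - A \<alpha>) * V}"

definition below_curve :: "real \<Rightarrow> real \<Rightarrow> real \<times> real \<Rightarrow> bool" where
  "below_curve \<alpha> V p \<longleftrightarrow>
     p \<in> quadrant \<and> snd p < (\<alpha> - A \<alpha>) * V * (fst p / (fst p + 1))"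

definition above_curve :: "real \<Rightarrow> real \<Rightarrow> real \<times> real \<Rightarrow> bool" where
  "above_curve \<alpha> V p \<longleftrightarrow>
     p \<in> quadrant \<and> snd p > (\<alpha> - A \<alpha>) * V * (fst p / (fst p + 1))"

definition level_curve :: "real \<Rightarrow> (real \<times> real) set" where
  "level_curve C = {(\<nu>, \<beta>). (\<nu>, \<beta>) \<in> quadrant \<and> \<beta>\<^sup>2 + \<nu>\<^sup>2 + 2 * \<nu> ^ 3 / 3 = C}"

text \<open>The velocities at \<open>p\<close> of differentiable paths running in \<open>S\<close>. Where \<open>S\<close> is a regular curve
  this is the direction of its tangent line, a one-dimensional subspace.\<close>

definition tangent_space :: "(real \<times> real) set \<Rightarrow> real \<times> real \<Rightarrow> (real \<times> real) set" where
  "tangent_space S p = {v. \<exists>\<gamma> :: real \<Rightarrow> real \<times> real.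
     \<gamma> 0 = p \<and> (\<forall>\<^sub>F s in nhds 0. \<gamma> s \<in> S) \<and> (\<gamma> has_vector_derivative v) (at 0)}"

definition orthogonal_at :: "(real \<times> real) set \<Rightarrow> (real \<times> real) set \<Rightarrow> real \<times> real \<Rightarrow> bool" where
  "orthogonal_at S S' p \<longleftrightarrow> (\<exists>u v. u \<noteq> 0 \<and> v \<noteq> 0 \<and>
     tangent_space S p = span {u} \<and> tangent_space S' p = span {v} \<and> orthogonal u v)"

end

theory Submission
  imports Defs "HOL-Probability.Distributions"
begin

text \<open>
  For a standard Gaussian \<open>Z\<close> put \<open>r(x) = E [x / (2 x + Z\<^sup>2)]\<close>, so that \<open>r(x) = x F(x)\<close>, and
  \<open>d(x) = (2 \<alpha> + 1) r(x) - \<alpha>\<close>. Both expectations in the system depend on the integral \<open>r\<close> at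
  \<open>x = \<sigma> / V\<close> alone, and the system reads
  \<open>\<beta>' = - d(\<sigma> / V) / \<beta>\<close>, \<open>\<nu>' = d(\<sigma> / V) / (\<nu> (\<nu> + 1))\<close>
  (lemmas \<open>E_dK_dbeta_drift\<close> and \<open>E_dK_dnu_drift\<close>).

  The function \<open>r\<close> increases strictly and continuously from 0 to 1/2 on the positive axis, hence
  \<open>d\<close> changes sign exactly once, at \<open>\<alpha> - A(\<alpha>)\<close> (lemma \<open>drift_root_A\<close>): the curve of equilibria is the
  set \<open>\<sigma> = (\<alpha> - A(\<alpha>)) V\<close>, and \<open>d\<close> is negative below it and positive above it.
  Since \<open>\<beta> \<beta>' + \<nu> (\<nu> + 1) \<nu>' = 0\<close>, the quantity \<open>\<beta>\<^sup>2 + \<nu>\<^sup>2 + 2 \<nu>\<^sup>3 / 3\<close> is conserved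
  (lemma \<open>solution_on_level_curve\<close>). On a level curve \<open>\<beta>\<close> is a decreasing function of \<open>\<nu>\<close>, so \<open>\<sigma>\<close> is
  one too (lemma \<open>sigma_anti\<close>). All else follows from this monotonicity.

  \<^item> A level curve meets the curve of equilibria in exactly one point \<open>(\<nu>\<^sub>*, \<beta>\<^sub>*)\<close>.
  \<^item> Forward uniqueness (lemma \<open>solution_unique\<close>): with \<open>w = \<nu>\<^sup>2 + 2 \<nu>\<^sup>3 / 3\<close> one has \<open>w' = 2 d(\<sigma> / V)\<close>,
    whose right-hand side decreases in \<open>w\<close> along the level curve, and therefore the squared distance
    between the values of \<open>w\<close> for two solutions on one level curve cannot grow.
  \<^item> Global existence (lemma \<open>global_solution\<close>): on a level curve the system is a scalar equation
    \<open>\<nu>' = g(\<nu>)\<close> whose right-hand side points towards \<open>\<nu>\<^sub>*\<close>. Separation of variables solves it, the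
    solution being the inverse of \<open>\<integral> 1 / g\<close>. Because \<open>r\<close> is Lipschitz away from 0, \<open>g\<close> vanishes at
    least linearly at \<open>\<nu>\<^sub>*\<close>, the integral diverges there, and the equilibrium is approached
    monotonically but never reached (lemma \<open>scalar_flow_up\<close>).

  By uniqueness every trajectory coincides with such a global solution, and maximality then forces
  \<open>T = \<infinity>\<close> (lemma \<open>trajectory_behaviour\<close>). Orthogonality holds because both curves are graphs over
  the \<open>\<nu>\<close>-axis whose slopes at a common point, \<open>- \<nu> (\<nu> + 1) / \<beta>\<close> and \<open>\<beta> / (\<nu> (\<nu> + 1))\<close>, have
  product -1.
\<close>

section \<open>The Gaussian mean in the right-hand sides\<close>

definition mean_ratio :: "real \<Rightarrow> real" where
  "mean_ratio x = (LINT z|lborel. std_normal_density z * (x / (2 * x + z\<^sup>2)))"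

lemma integrable_std_normal_times:
  assumes [measurable]: "f \<in> borel_measurable borel" and "\<And>z. \<bar>f z\<bar> \<le> c"
  shows "integrable lborel (\<lambda>z. std_normal_density z * f z)"
proof (rule Bochner_Integration.integrable_bound[where f = "\<lambda>z. c * std_normal_density z"])
  show "integrable lborel (\<lambda>z. c * std_normal_density z)" by simp
  show "AE z in lborel. norm (std_normal_density z * f z) \<le> norm (c * std_normal_density z)"
  proof (rule AE_I2)
    fix z :: real
    have "\<bar>f z\<bar> \<le> \<bar>c\<bar>" using assms(2)[of z] by linarith
    then show "norm (std_normal_density z * f z) \<le> norm (c * std_normal_density z)"
      by (simp add: abs_mult mult.commute mult_right_mono)
  qed
qed measurable

lemma ratio_bounds:
  fixes x z :: real assumes "x > 0"
  shows "0 \<le> x / (2 * x + z\<^sup>2)" "x / (2 * x + z\<^sup>2) \<le> 1 / 2"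
proof -
  have "0 < 2 * x + z\<^sup>2" using assms by (simp add: add_pos_nonneg)
  then show "0 \<le> x / (2 * x + z\<^sup>2)" "x / (2 * x + z\<^sup>2) \<le> 1 / 2"
    using assms by (auto simp: field_simps)
qed

lemma integrable_ratio:
  assumes "x > 0"
  shows "integrable lborel (\<lambda>z. std_normal_density z * (x / (2 * x + z\<^sup>2)))"
proof (rule integrable_std_normal_times)
  show "\<bar>x / (2 * x + z\<^sup>2)\<bar> \<le> 1 / 2" for z using ratio_bounds[OF assms, of z] by linarith
qed measurable

text \<open>The numerator \<open>z\<^sup>2\<close> on the right makes the difference positive for almost every \<open>z\<close>, which gives
  strict monotonicity of the mean, and cancels against \<open>2 y + z\<^sup>2\<close>, which gives the Lipschitz bound.\<close>

lemma ratio_diff: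
  fixes x y z :: real assumes "x > 0" "y > 0"
  shows "y / (2 * y + z\<^sup>2) - x / (2 * x + z\<^sup>2) = (y - x) * (z\<^sup>2 / ((2 * x + z\<^sup>2) * (2 * y + z\<^sup>2)))"
proof -
  have "0 < 2 * x + z\<^sup>2" "0 < 2 * y + z\<^sup>2" using assms by (simp_all add: add_pos_nonneg)
  then show ?thesis by (simp add: field_simps)
qed

lemma integral_strict_mono_AE_lborel:
  fixes f g :: "real \<Rightarrow> real"
  assumes "integrable lborel f" "integrable lborel g" "AE z in lborel. f z < g z"
  shows "(LINT z|lborel. f z) < (LINT z|lborel. g z)"
proof -
  have int: "integrable lborel (\<lambda>z. g z - f z)" using assms by simp
  have nonneg: "AE z in lborel. 0 \<le> g z - f z"
    using assms(3) by eventually_elim simp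
  have "(LINT z|lborel. g z - f z) \<noteq> 0"
  proof
    assume "(LINT z|lborel. g z - f z) = 0"
    then have "AE z in lborel. g z - f z = 0"
      using integral_nonneg_eq_0_iff_AE[OF int nonneg] by simp
    with assms(3) have "AE z in (lborel :: real measure). False"
      by eventually_elim simp
    then have "(UNIV :: real set) \<in> null_sets lborel"
      using AE_iff_null[of "lborel :: real measure" "\<lambda>_. False"] by simp
    then show False by (simp add: null_sets_def)
  qed
  moreover have "0 \<le> (LINT z|lborel. g z - f z)" by (rule integral_nonneg_AE[OF nonneg])
  moreover have "(LINT z|lborel. g z - f z) = (LINT z|lborel. g z) - (LINT z|lborel. f z)"
    using assms by (intro Bochner_Integration.integral_diff)
  ultimately show ?thesis by linarith
qed

lemma mean_ratio_strict_mono: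
  assumes "0 < x" "x < y" shows "mean_ratio x < mean_ratio y"
  unfolding mean_ratio_def
proof (rule integral_strict_mono_AE_lborel)
  have "AE z in lborel. z \<noteq> (0::real)" by (rule AE_lborel_singleton)
  then show "AE z in lborel. std_normal_density z * (x / (2 * x + z\<^sup>2)) < std_normal_density z * (y / (2 * y + z\<^sup>2))"
  proof eventually_elim
    case (elim z)
    have "0 < (y - x) * (z\<^sup>2 / ((2 * x + z\<^sup>2) * (2 * y + z\<^sup>2)))"
      using assms elim by (intro mult_pos_pos divide_pos_pos add_pos_pos) auto
    then have "x / (2 * x + z\<^sup>2) < y / (2 * y + z\<^sup>2)"
      using ratio_diff[of x y z] assms by linarith
    then show ?case by (intro mult_strict_left_mono) (auto intro: normal_density_pos)
  qed
qed (use assms integrable_ratio in auto)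

text \<open>In the identity \<open>ratio_diff\<close> the factor \<open>z\<^sup>2 / (2 y + z\<^sup>2)\<close> is at most 1, and
  \<open>1 / (2 x + z\<^sup>2)\<close> is at most \<open>1 / (2 x)\<close>; the bound depends on one of the two points only.\<close>

lemma mean_ratio_lipschitz:
  assumes "0 < x" "0 < y" shows "\<bar>mean_ratio y - mean_ratio x\<bar> \<le> \<bar>y - x\<bar> / (2 * x)"
proof -
  have "\<bar>mean_ratio y - mean_ratio x\<bar> = \<bar>LINT z|lborel. std_normal_density z * (y / (2 * y + z\<^sup>2)) - std_normal_density z * (x / (2 * x + z\<^sup>2))\<bar>"
    unfolding mean_ratio_def by (subst Bochner_Integration.integral_diff) (use assms integrable_ratio in auto)
  also have "\<dots> \<le> (LINT z|lborel. \<bar>std_normal_density z * (y / (2 * y + z\<^sup>2)) - std_normal_density z * (x / (2 * x + z\<^sup>2))\<bar>)"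
    by (rule integral_abs_bound)
  also have "\<dots> \<le> (LINT z|lborel. std_normal_density z * (\<bar>y - x\<bar> / (2 * x)))"
  proof (rule integral_mono)
    fix z :: real
    have "z\<^sup>2 / ((2 * x + z\<^sup>2) * (2 * y + z\<^sup>2)) = (z\<^sup>2 / (2 * y + z\<^sup>2)) * (1 / (2 * x + z\<^sup>2))" by simp
    also have "\<dots> \<le> 1 * (1 / (2 * x))"
      using assms by (intro mult_mono divide_left_mono) (auto simp: divide_simps add_pos_nonneg add_nonneg_pos)
    finally have "\<bar>y - x\<bar> * (z\<^sup>2 / ((2 * x + z\<^sup>2) * (2 * y + z\<^sup>2))) \<le> \<bar>y - x\<bar> * (1 / (2 * x))"
      by (intro mult_left_mono) auto
    then have "\<bar>y / (2 * y + z\<^sup>2) - x / (2 * x + z\<^sup>2)\<bar> \<le> \<bar>y - x\<bar> / (2 * x)"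
      using ratio_diff[of x y z] assms by (simp add: abs_mult)
    then have "std_normal_density z * \<bar>y / (2 * y + z\<^sup>2) - x / (2 * x + z\<^sup>2)\<bar> \<le> std_normal_density z * (\<bar>y - x\<bar> / (2 * x))"
      by (intro mult_left_mono) auto
    then show "\<bar>std_normal_density z * (y / (2 * y + z\<^sup>2)) - std_normal_density z * (x / (2 * x + z\<^sup>2))\<bar> \<le> std_normal_density z * (\<bar>y - x\<bar> / (2 * x))"
      by (simp add: right_diff_distrib[symmetric] abs_mult del: times_divide_eq_right)
  qed (use assms integrable_ratio in \<open>auto intro!: integrable_abs\<close>)
  also have "\<dots> = \<bar>y - x\<bar> / (2 * x)" by simp
  finally show ?thesis .
qed

text \<open>The integrand tends to 0 for \<open>z \<noteq> 0\<close> and is dominated by half the Gaussian density; the same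
  majorant serves for large arguments, where the integrand tends to it.\<close>

lemma mean_ratio_small: "(\<lambda>n. mean_ratio (1 / real (Suc n))) \<longlonglongrightarrow> 0"
proof -
  have pos: "0 < 1 / real (Suc n)" for n by simp
  have "(\<lambda>n. mean_ratio (1 / real (Suc n))) \<longlonglongrightarrow> (LINT z|(lborel :: real measure). (0::real))"
    unfolding mean_ratio_def
  proof (rule integral_dominated_convergence[where w = "\<lambda>z. std_normal_density z * (1/2)"])
    have "AE z in lborel. z \<noteq> (0::real)" by (rule AE_lborel_singleton)
    then show "AE z in lborel. (\<lambda>n. std_normal_density z * (1 / real (Suc n) / (2 * (1 / real (Suc n)) + z\<^sup>2))) \<longlonglongrightarrow> 0"
    proof eventually_elim
      case (elim z)
      have "(\<lambda>n. std_normal_density z * (1 / real (Suc n) / (2 * (1 / real (Suc n)) + z\<^sup>2))) \<longlonglongrightarrow> std_normal_density z * (0 / (2 * 0 + z\<^sup>2))"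
        using elim by (intro tendsto_intros LIMSEQ_Suc[OF lim_1_over_n]) auto
      then show ?case by simp
    qed
    show "AE z in lborel. norm (std_normal_density z * (1 / real (Suc n) / (2 * (1 / real (Suc n)) + z\<^sup>2))) \<le> std_normal_density z * (1/2)" for n
    proof (rule AE_I2)
      fix z :: real
      show "norm (std_normal_density z * (1 / real (Suc n) / (2 * (1 / real (Suc n)) + z\<^sup>2))) \<le> std_normal_density z * (1/2)"
        unfolding real_norm_def abs_mult
        using ratio_bounds[OF pos[of n], of z]
        by (intro mult_mono) (simp_all del: of_nat_Suc add: abs_of_nonneg)
    qed
  qed simp_all
  then show ?thesis by simp
qed

lemma mean_ratio_large: "(\<lambda>n. mean_ratio (real (Suc n))) \<longlonglongrightarrow> 1 / 2"
proof -
  have pos: "0 < real (Suc n)" for n by simp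
  have "(\<lambda>n. mean_ratio (real (Suc n))) \<longlonglongrightarrow> (LINT z|lborel. std_normal_density z * (1/2))"
    unfolding mean_ratio_def
  proof (rule integral_dominated_convergence[where w = "\<lambda>z. std_normal_density z * (1/2)"])
    show "AE z in lborel. (\<lambda>n. std_normal_density z * (real (Suc n) / (2 * real (Suc n) + z\<^sup>2))) \<longlonglongrightarrow> std_normal_density z * (1/2)"
    proof (rule AE_I2)
      fix z :: real
      have "(\<lambda>n. std_normal_density z * (1 / (2 + z\<^sup>2 * (1 / real (Suc n))))) \<longlonglongrightarrow> std_normal_density z * (1 / (2 + z\<^sup>2 * 0))"
        by (intro tendsto_intros LIMSEQ_Suc[OF lim_1_over_n]) auto
      moreover have "1 / (2 + z\<^sup>2 * (1 / real (Suc n))) = real (Suc n) / (2 * real (Suc n) + z\<^sup>2)" for n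
      proof -
        have "0 < 2 * real (Suc n) + z\<^sup>2" by (intro add_pos_nonneg) auto
        then show ?thesis by (simp add: field_simps)
      qed
      ultimately show "(\<lambda>n. std_normal_density z * (real (Suc n) / (2 * real (Suc n) + z\<^sup>2))) \<longlonglongrightarrow> std_normal_density z * (1/2)"
        by (simp only: mult_zero_right add_0_right)
    qed
    show "AE z in lborel. norm (std_normal_density z * (real (Suc n) / (2 * real (Suc n) + z\<^sup>2))) \<le> std_normal_density z * (1/2)" for n
    proof (rule AE_I2)
      fix z :: real
      show "norm (std_normal_density z * (real (Suc n) / (2 * real (Suc n) + z\<^sup>2))) \<le> std_normal_density z * (1/2)"
        unfolding real_norm_def abs_mult
        using ratio_bounds[OF pos[of n], of z]
        by (intro mult_mono) (simp_all del: of_nat_Suc add: abs_of_nonneg)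
    qed
  qed simp_all
  then show ?thesis by simp
qed

lemma continuous_on_mean_ratio: "continuous_on {0<..} mean_ratio"
proof (rule continuous_onI)
  fix x e :: real assume x: "x \<in> {0<..}" and e: "0 < e"
  show "\<exists>d>0. \<forall>y\<in>{0<..}. dist y x < d \<longrightarrow> dist (mean_ratio y) (mean_ratio x) \<le> e"
  proof (intro exI[of _ "2 * x * e"] conjI ballI impI)
    fix y :: real assume y: "y \<in> {0<..}" and d: "dist y x < 2 * x * e"
    have "\<bar>mean_ratio y - mean_ratio x\<bar> \<le> \<bar>y - x\<bar> / (2 * x)" using mean_ratio_lipschitz x y by simp
    also have "\<dots> \<le> e" using d x by (simp add: dist_real_def field_simps)
    finally show "dist (mean_ratio y) (mean_ratio x) \<le> e" by (simp add: dist_real_def)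
  qed (use x e in auto)
qed

text \<open>The intermediate value theorem between a small and a large argument; uniqueness is strict
  monotonicity.\<close>

lemma mean_ratio_solve:
  assumes "0 < c" "c < 1 / 2"
  shows "\<exists>!x. 0 < x \<and> mean_ratio x = c"
proof -
  obtain m where m: "mean_ratio (1 / real (Suc m)) < c"
    using order_tendstoD(2)[OF mean_ratio_small assms(1)] by (auto simp: eventually_sequentially)
  obtain n where n: "c < mean_ratio (real (Suc n))"
    using order_tendstoD(1)[OF mean_ratio_large assms(2)] by (auto simp: eventually_sequentially)
  have "1 / real (Suc m) \<le> 1" "1 \<le> real (Suc n)" by auto
  then have le: "1 / real (Suc m) \<le> real (Suc n)" by linarith
  have sub: "{1 / real (Suc m)..real (Suc n)} \<subseteq> {0<..}"
    by (auto intro: less_le_trans[of 0 "1 / real (Suc m)"])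
  obtain x where x: "1 / real (Suc m) \<le> x" "mean_ratio x = c"
    using IVT'[of mean_ratio "1 / real (Suc m)" c "real (Suc n)"] m n le continuous_on_subset[OF continuous_on_mean_ratio sub] by auto
  have "0 < x" using x(1) by (rule less_le_trans[rotated]) simp
  moreover have "y = x" if "0 < y" "mean_ratio y = c" for y
    using mean_ratio_strict_mono[of x y] mean_ratio_strict_mono[of y x] that x(2) \<open>0 < x\<close> by (cases x y rule: linorder_cases) auto
  ultimately show ?thesis using x(2) by blast
qed

lemma mean_ratio_eq_F: "mean_ratio x = x * F x"
proof -
  have "mean_ratio x = (LINT z|lborel. (x / sqrt (2 * pi)) * (1 / (2 * x + z\<^sup>2) * exp (- z\<^sup>2 / 2)))"
    unfolding mean_ratio_def by (rule Bochner_Integration.integral_cong) (simp_all add: std_normal_density_def)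
  then show ?thesis by (simp add: F_def del: times_divide_eq_left)
qed

text \<open>The common factor of the two components of the vector field; its sign decides the direction of
  motion.\<close>

definition drift :: "real \<Rightarrow> real \<Rightarrow> real" where
  "drift \<alpha> x = (2 * \<alpha> + 1) * mean_ratio x - \<alpha>"

lemma E_dK_dbeta_drift:
  assumes "V > 0" "sigma \<nu> \<beta> > 0"
  shows "E_dK_dbeta \<alpha> V \<nu> \<beta> = drift \<alpha> (sigma \<nu> \<beta> / V) / \<beta>"
proof -
  define x where "x = sigma \<nu> \<beta> / V"
  have x: "x > 0" using assms by (simp add: x_def)
  have "(LINT z|lborel. 1 / (1 + V / sigma \<nu> \<beta> * (z\<^sup>2 / 2)) * exp (- z\<^sup>2 / 2))
      = (LINT z|lborel. (2 * sqrt (2 * pi)) * (std_normal_density z * (x / (2 * x + z\<^sup>2))))"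
  proof (rule Bochner_Integration.integral_cong)
    fix z :: real
    have "0 < 2 * x + z\<^sup>2" using x by (simp add: add_pos_nonneg)
    moreover have "V / sigma \<nu> \<beta> = 1 / x" by (simp add: x_def)
    ultimately have "1 / (1 + V / sigma \<nu> \<beta> * (z\<^sup>2 / 2)) = 2 * x / (2 * x + z\<^sup>2)"
      using x by (simp only:) (simp add: divide_simps)
    then show "1 / (1 + V / sigma \<nu> \<beta> * (z\<^sup>2 / 2)) * exp (- z\<^sup>2 / 2) = (2 * sqrt (2 * pi)) * (std_normal_density z * (x / (2 * x + z\<^sup>2)))"
      by (simp add: std_normal_density_def)
  qed simp
  also have "\<dots> = 2 * sqrt (2 * pi) * mean_ratio x" by (simp add: mean_ratio_def del: times_divide_eq_right)
  finally have I: "(LINT z|lborel. 1 / (1 + V / sigma \<nu> \<beta> * (z\<^sup>2 / 2)) * exp (- z\<^sup>2 / 2)) = 2 * sqrt (2 * pi) * mean_ratio x" .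
  have "(\<alpha> + 1 / 2) / sqrt (2 * pi) * (2 * sqrt (2 * pi) * mean_ratio x) - \<alpha> = drift \<alpha> x"
    by (simp add: drift_def)
  then show ?thesis unfolding E_dK_dbeta_def I x_def[symmetric] by simp
qed

text \<open>Here the integrand is turned into the one of \<^const>\<open>mean_ratio\<close> by
  \<open>z\<^sup>2 / (2 x + z\<^sup>2) = 1 - 2 x / (2 x + z\<^sup>2)\<close>.\<close>

lemma E_dK_dnu_drift:
  assumes "V > 0" "sigma \<nu> \<beta> > 0"
  shows "E_dK_dnu \<alpha> V \<nu> \<beta> = - drift \<alpha> (sigma \<nu> \<beta> / V) / (\<nu> * (\<nu> + 1))"
proof -
  define x where "x = sigma \<nu> \<beta> / V"
  have x: "x > 0" using assms by (simp add: x_def)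
  have "(LINT z|lborel. z\<^sup>2 / (2 * sigma \<nu> \<beta> / V + z\<^sup>2) * exp (- z\<^sup>2 / 2))
      = (LINT z|lborel. sqrt (2 * pi) * (std_normal_density z - 2 * (std_normal_density z * (x / (2 * x + z\<^sup>2)))))"
  proof (rule Bochner_Integration.integral_cong)
    fix z :: real
    have "0 < 2 * x + z\<^sup>2" using x by (simp add: add_pos_nonneg)
    then have "z\<^sup>2 / (2 * x + z\<^sup>2) = 1 - 2 * (x / (2 * x + z\<^sup>2))"
      by (simp add: field_simps)
    then have "z\<^sup>2 / (2 * x + z\<^sup>2) * exp (- z\<^sup>2 / 2) = sqrt (2 * pi) * (std_normal_density z * (1 - 2 * (x / (2 * x + z\<^sup>2))))"
      by (simp add: std_normal_density_def)
    then show "z\<^sup>2 / (2 * sigma \<nu> \<beta> / V + z\<^sup>2) * exp (- z\<^sup>2 / 2) = sqrt (2 * pi) * (std_normal_density z - 2 * (std_normal_density z * (x / (2 * x + z\<^sup>2))))"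
      by (simp add: x_def algebra_simps)
  qed simp
  also have "\<dots> = sqrt (2 * pi) * (1 - 2 * mean_ratio x)"
    using integrable_ratio[OF x] by (simp add: mean_ratio_def del: times_divide_eq_right)
  finally have I: "(LINT z|lborel. z\<^sup>2 / (2 * sigma \<nu> \<beta> / V + z\<^sup>2) * exp (- z\<^sup>2 / 2)) = sqrt (2 * pi) * (1 - 2 * mean_ratio x)" .
  have "(2 * \<alpha> + 1) / sqrt (2 * pi) * (sqrt (2 * pi) * (1 - 2 * mean_ratio x)) - 1 = - 2 * drift \<alpha> x"
    by (simp add: drift_def) (simp add: field_simps)
  then show ?thesis unfolding E_dK_dnu_def I x_def[symmetric] by simp
qed

section \<open>Scalar autonomous equations approaching a zero\<close>

text \<open>Separation of variables: the solution is the inverse of the travel time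
  \<open>\<tau>(x) = \<integral>\<^sub>a\<^sup>x 1 / g\<close>. The linear bound on \<open>g\<close> near \<open>b\<close> makes \<open>\<tau>\<close> grow at least like
  \<open>- ln (b - x) / L\<close>, so the inverse is defined for all times and stays below \<open>b\<close>.\<close>

lemma scalar_flow_up:
  fixes g :: "real \<Rightarrow> real"
  assumes ab: "a < b" and cont: "continuous_on {a..<b} g" and pos: "\<And>x. x \<in> {a..<b} \<Longrightarrow> 0 < g x"
    and lip: "\<forall>\<^sub>F x in at_left b. g x \<le> L * (b - x)"
  obtains x where "x 0 = a" "\<And>t. 0 \<le> t \<Longrightarrow> x t \<in> {a..<b}"
    "\<And>t. 0 \<le> t \<Longrightarrow> (x has_real_derivative g (x t)) (at t)"
    "strict_mono_on {0..} x" "(x \<longlongrightarrow> b) at_top"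
proof -
  \<comment> \<open>Extending \<open>g\<close> by a constant to the left of \<open>a\<close> makes the initial time an interior point of the range of \<open>\<tau>\<close>, so that the derivative at time 0 is two-sided.\<close>
  define h where "h x = g (max a x)" for x
  have h_pos: "0 < h x" if "x < b" for x using that ab by (auto simp: h_def intro!: pos)
  have h_cont: "continuous_on {..<b} h"
    unfolding h_def by (rule continuous_on_compose2[OF cont]) (auto intro!: continuous_intros simp: ab)
  have r_cont: "continuous_on {..<b} (\<lambda>x. 1 / h x)"
    using h_pos by (intro continuous_intros h_cont) (force dest: h_pos)
  define \<tau> where "\<tau> x = integral {a - 1..x} (\<lambda>x. 1 / h x) - integral {a - 1..a} (\<lambda>x. 1 / h x)" for x
  have der: "(\<tau> has_real_derivative 1 / h x) (at x)" if x: "a - 1 < x" "x < b" for x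
  proof -
    define c where "c = (x + b) / 2"
    have c: "x < c" "c < b" using x by (simp_all add: c_def)
    have "((\<lambda>x. integral {a - 1..x} (\<lambda>x. 1 / h x)) has_real_derivative 1 / h x) (at x within {a - 1..c})"
      using x c by (intro integral_has_real_derivative continuous_on_subset[OF r_cont]) auto
    moreover have "at x within {a - 1..c} = at x"
      using x c by (intro at_within_interior) simp
    ultimately show ?thesis unfolding \<tau>_def by (auto intro!: derivative_eq_intros)
  qed
  have tau_a: "\<tau> a = 0" by (simp add: \<tau>_def)
  have tau_mono: "\<tau> x < \<tau> y" if "a - 1 < x" "x < y" "y < b" for x y
  proof (rule DERIV_pos_imp_increasing[OF that(2)])
    fix z assume "x \<le> z" "z \<le> y"
    then show "\<exists>d. (\<tau> has_real_derivative d) (at z) \<and> 0 < d"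
      using der[of z] h_pos[of z] that by auto
  qed
  have tau_cont: "continuous_on {a - 1<..<b} \<tau>"
    by (rule continuous_at_imp_continuous_on) (auto intro!: DERIV_isCont[OF der])
  have unbounded: "\<exists>x. a < x \<and> x < b \<and> M \<le> \<tau> x" for M
  proof -
    obtain c where c: "a < c" "c < b" and bd: "\<And>x. c < x \<Longrightarrow> x < b \<Longrightarrow> g x \<le> L * (b - x)"
    proof -
      obtain c0 where c0: "c0 < b" "\<And>x. c0 < x \<Longrightarrow> x < b \<Longrightarrow> g x \<le> L * (b - x)"
        using lip unfolding eventually_at_left_field by blast
      show ?thesis
        by (rule that[of "(max a c0 + b) / 2"]) (use c0 ab in \<open>auto simp: max_def intro!: c0(2) split: if_splits\<close>)
    qed
    have L: "0 < L"
    proof -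
      have "0 < g ((c + b) / 2)" using c by (intro pos) auto
      also have "\<dots> \<le> L * (b - (c + b) / 2)" using c by (intro bd) auto
      finally show ?thesis using c by (simp add: zero_less_mult_iff)
    qed
    define d where "d = (c + b) / 2"
    have d: "c < d" "d < b" using c by (auto simp: d_def)
    have grow: "\<tau> d + (ln (b - d) - ln (b - x)) / L \<le> \<tau> x" if x: "d \<le> x" "x < b" for x
    proof -
      have "\<tau> d + ln (b - d) / L \<le> \<tau> x + ln (b - x) / L"
      proof (rule DERIV_nonneg_imp_nondecreasing[OF x(1)])
        fix z assume z: "d \<le> z" "z \<le> x"
        have gz: "0 < g z" "g z \<le> L * (b - z)" "h z = g z" using z x d c bd[of z] by (auto intro!: pos simp: h_def)
        have "((\<lambda>x. \<tau> x + ln (b - x) / L) has_real_derivative 1 / g z - 1 / (L * (b - z))) (at z)"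
          using z x d c L by (auto intro!: derivative_eq_intros der simp: gz(3)[symmetric])
        moreover have "1 / (L * (b - z)) \<le> 1 / g z" using gz by (intro divide_left_mono) auto
        ultimately show "\<exists>y. ((\<lambda>x. \<tau> x + ln (b - x) / L) has_real_derivative y) (at z) \<and> 0 \<le> y"
          by (metis diff_ge_0_iff_ge)
      qed
      then show ?thesis by (simp add: diff_divide_distrib)
    qed
    \<comment> \<open>This point is so close to \<open>b\<close> that the logarithmic lower bound on \<open>\<tau>\<close> exceeds \<open>M\<close>.\<close>
    define e where "e = exp (- L * \<bar>M - \<tau> d\<bar>)"
    define x where "x = b - (b - d) * e"
    have e: "0 < e" "e \<le> 1" using L by (simp_all add: e_def)
    then have "(b - d) * e \<le> b - d" using d by (intro mult_left_le) auto
    then have "d \<le> x" unfolding x_def by linarith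
    moreover have "x < b" using d e by (simp add: x_def)
    ultimately have x: "d \<le> x" "x < b" by simp_all
    have "ln (b - x) = ln (b - d) - L * \<bar>M - \<tau> d\<bar>" using d by (simp add: x_def e_def ln_mult)
    then have "M \<le> \<tau> x" using grow[OF x] L by simp
    then show ?thesis using x d c by (intro exI[of _ x]) auto
  qed
  define lo where "lo = \<tau> (a - 1/2)"
  have lo: "lo < 0" unfolding lo_def tau_a[symmetric] using ab by (intro tau_mono) auto
  have ex: "\<exists>x. a - 1/2 < x \<and> x < b \<and> \<tau> x = t" if "lo < t" for t
  proof -
    obtain y where y: "a < y" "y < b" "t \<le> \<tau> y" using unbounded by blast
    have "\<exists>x\<ge>a - 1/2. x \<le> y \<and> \<tau> x = t"
      using that y by (intro IVT' continuous_on_subset[OF tau_cont]) (auto simp: lo_def)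
    then obtain x where x: "a - 1/2 \<le> x" "x \<le> y" "\<tau> x = t" by blast
    then have "x \<noteq> a - 1/2" using that by (auto simp: lo_def)
    then show ?thesis using x y by (intro exI[of _ x]) auto
  qed
  define x where "x t = (SOME x. a - 1/2 < x \<and> x < b \<and> \<tau> x = t)" for t
  have x: "a - 1/2 < x t" "x t < b" "\<tau> (x t) = t" if "lo < t" for t
    using someI_ex[OF ex[OF that]] unfolding x_def by auto
  have x_unique: "x t = y" if "a - 1/2 < y" "y < b" "\<tau> y = t" "lo < t" for t y
    using tau_mono[of y "x t"] tau_mono[of "x t" y] x[OF that(4)] that by (cases y "x t" rule: linorder_cases) auto
  have x_mono: "x s < x t" if "lo < s" "s < t" for s t
    using tau_mono[of "x t" "x s"] x[of s] x[of t] that by (cases "x s" "x t" rule: linorder_cases) auto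
  have x0: "x 0 = a" using ab tau_a lo by (intro x_unique) auto
  have x_ge: "a \<le> x t" if "0 \<le> t" for t using x_mono[of 0 t] lo that x0 by (cases "t = 0") auto
  have x_cont: "isCont x t" if t: "lo < t" for t
  proof -
    define l u where "l = (a - 1/2 + x t) / 2" and "u = (x t + b) / 2"
    have lu: "a - 1/2 < l" "l < x t" "x t < u" "u < b" using x[OF t] by (auto simp: l_def u_def)
    have inv: "x (\<tau> z) = z" if "a - 1/2 < z" "z < b" for z
      using that tau_mono[of "a - 1/2" z] by (intro x_unique) (auto simp: lo_def)
    define d where "d = min (x t - l) (u - x t)"
    have "isCont x (\<tau> (x t))"
    proof (rule isCont_inverse_function[where d = d and f = \<tau> and x = "x t"])
      show "0 < d" using lu by (simp add: d_def)
      fix z assume "\<bar>z - x t\<bar> \<le> d"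
      then have "l \<le> z" "z \<le> u" by (auto simp: d_def)
      then have "a - 1/2 < z" "z < b" using lu by auto
      then show "x (\<tau> z) = z" "isCont \<tau> z" using inv by (auto intro!: DERIV_isCont[OF der])
    qed
    then show ?thesis using x[OF t] by simp
  qed
  have x_der: "(x has_real_derivative g (x t)) (at t)" if t: "0 \<le> t" for t
  proof -
    have lt: "lo < t" using lo t by simp
    have "(x has_real_derivative inverse (1 / h (x t))) (at t)"
    proof (rule DERIV_inverse_function[where f = \<tau> and a = lo and b = "t + 1"])
      show "(\<tau> has_real_derivative 1 / h (x t)) (at (x t))" using x[OF lt] by (intro der) auto
      show "1 / h (x t) \<noteq> 0" using h_pos[OF x(2)[OF lt]] by simp
    qed (use lt x x_cont in auto)
    then show ?thesis using x_ge[OF t] by (simp add: h_def max_absorb2)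
  qed
  have lim: "(x \<longlongrightarrow> b) at_top"
  proof (rule order_tendstoI)
    fix c assume "c < b"
    define d where "d = max a c"
    have d: "a \<le> d" "c \<le> d" "d < b" using \<open>c < b\<close> ab by (auto simp: d_def)
    show "\<forall>\<^sub>F t in at_top. c < x t"
    proof (rule eventually_at_top_linorderI[of "max 0 (\<tau> d) + 1"])
      fix t assume t: "max 0 (\<tau> d) + 1 \<le> t"
      have "lo < t" using t lo by auto
      then have "\<not> x t \<le> d" using x[of t] tau_mono[of "x t" d] d t by (cases "x t = d") auto
      then show "c < x t" using d by simp
    qed
  next
    fix c assume "b < c"
    then show "\<forall>\<^sub>F t in at_top. x t < c"
      using x(2) lo by (intro eventually_at_top_linorderI[of 0]) (auto intro: less_trans less_le_trans)
  qed
  show ?thesis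
  proof (rule that[of x])
    show "strict_mono_on {0..} x" using x_mono lo by (auto intro!: strict_mono_onI)
  qed (use x0 x_ge x lo x_der lim in auto)
qed

text \<open>The reflection \<open>y = - x\<close> turns a decreasing flow into an increasing one.\<close>

lemma scalar_flow_down:
  fixes g :: "real \<Rightarrow> real"
  assumes ab: "b < a" and cont: "continuous_on {b<..a} g" and neg: "\<And>x. x \<in> {b<..a} \<Longrightarrow> g x < 0"
    and lip: "\<forall>\<^sub>F x in at_right b. - g x \<le> L * (x - b)"
  obtains x where "x 0 = a" "\<And>t. 0 \<le> t \<Longrightarrow> x t \<in> {b<..a}"
    "\<And>t. 0 \<le> t \<Longrightarrow> (x has_real_derivative g (x t)) (at t)"
    "strict_antimono_on {0..} x" "(x \<longlongrightarrow> b) at_top"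
proof -
  have "continuous_on {-a..<-b} (\<lambda>y. - g (- y))"
    by (intro continuous_intros continuous_on_compose2[OF cont]) auto
  moreover have "\<forall>\<^sub>F y in at_left (- b). - g (- y) \<le> L * (- b - y)"
    using lip by (simp add: at_right_minus[of b] eventually_filtermap minus_diff_commute)
  ultimately obtain y where y: "y 0 = - a" "\<And>t. 0 \<le> t \<Longrightarrow> y t \<in> {-a..<-b}"
    "\<And>t. 0 \<le> t \<Longrightarrow> (y has_real_derivative - g (- y t)) (at t)"
    "strict_mono_on {0..} y" "(y \<longlongrightarrow> - b) at_top"
    using scalar_flow_up[of "-a" "-b" "\<lambda>y. - g (- y)" L] ab neg by auto
  show ?thesis
  proof (rule that[of "\<lambda>t. - y t"])
    show "- y t \<in> {b<..a}" if "0 \<le> t" for t using y(2)[OF that] by auto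
    show "((\<lambda>t. - y t) has_real_derivative g (- y t)) (at t)" if "0 \<le> t" for t
      using DERIV_minus[OF y(3)[OF that]] by simp
    show "strict_antimono_on {0..} (\<lambda>t. - y t)"
      using y(4) by (auto simp: monotone_on_def)
    show "((\<lambda>t. - y t) \<longlongrightarrow> b) at_top" using tendsto_minus[OF y(5)] by simp
  qed (use y(1) in auto)
qed

section \<open>Sign of the drift\<close>

lemma drift_strict_mono:
  assumes "\<alpha> > 0" "0 < x" "x < y" shows "drift \<alpha> x < drift \<alpha> y"
  using mean_ratio_strict_mono[OF assms(2,3)] assms(1) by (simp add: drift_def)

lemma continuous_on_drift: "continuous_on {0<..} (drift \<alpha>)"
  unfolding drift_def by (intro continuous_intros continuous_on_mean_ratio)

text \<open>Since \<open>r(x) = x F(x)\<close>, the equation that defines \<^const>\<open>A\<close> says that the drift vanishes at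
  \<open>\<alpha> - A(\<alpha>)\<close>; hence it has exactly one solution and the description operator picks it.\<close>

lemma drift_root_A:
  assumes "\<alpha> > 0"
  obtains x where "0 < x" "drift \<alpha> x = 0" "A \<alpha> = \<alpha> - x"
proof -
  have c: "0 < \<alpha> / (2 * \<alpha> + 1)" "\<alpha> / (2 * \<alpha> + 1) < 1 / 2" using assms by (auto simp: field_simps)
  obtain x where x: "0 < x" "mean_ratio x = \<alpha> / (2 * \<alpha> + 1)"
    "\<And>y. 0 < y \<Longrightarrow> mean_ratio y = \<alpha> / (2 * \<alpha> + 1) \<Longrightarrow> y = x" using mean_ratio_solve[OF c] by blast
  have F_iff: "F y = \<alpha> / ((2 * \<alpha> + 1) * y) \<longleftrightarrow> mean_ratio y = \<alpha> / (2 * \<alpha> + 1)" if "0 < y" for y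
    using that assms by (simp add: mean_ratio_eq_F nonzero_eq_divide_eq mult_ac)
  have "A \<alpha> = \<alpha> - x"
    unfolding A_def
  proof (rule the_equality)
    show "\<alpha> - x < \<alpha> \<and> F (\<alpha> - (\<alpha> - x)) = \<alpha> / ((2 * \<alpha> + 1) * (\<alpha> - (\<alpha> - x)))"
      using x(1,2) F_iff[OF x(1)] by simp
    fix a assume "a < \<alpha> \<and> F (\<alpha> - a) = \<alpha> / ((2 * \<alpha> + 1) * (\<alpha> - a))"
    then have "\<alpha> - a = x" using F_iff[of "\<alpha> - a"] x(3)[of "\<alpha> - a"] by simp
    then show "a = \<alpha> - x" by simp
  qed
  moreover have "drift \<alpha> x = 0" using x(2) assms by (simp add: drift_def)
  ultimately show ?thesis using x(1) that by blast
qed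

section \<open>Geometry of the level curves\<close>

text \<open>The part of the conserved quantity that depends on \<open>\<nu>\<close>; it increases on the positive axis and
  can replace \<open>\<nu>\<close> as a coordinate on a level curve.\<close>

definition pot :: "real \<Rightarrow> real" where "pot x = x\<^sup>2 + 2 * x ^ 3 / 3"

lemma pot_less: assumes "0 \<le> x" "x < y" shows "pot x < pot y"
proof -
  have "x\<^sup>2 < y\<^sup>2" "x ^ 3 < y ^ 3" using assms by (auto intro: power_strict_mono)
  then show ?thesis by (simp add: pot_def)
qed

lemma pot_le: assumes "0 \<le> x" "x \<le> y" shows "pot x \<le> pot y"
  using pot_less[of x y] assms by (cases "x = y") auto

lemma DERIV_pot:
  "(f has_real_derivative d) (at x within S) \<Longrightarrow> ((\<lambda>x. pot (f x)) has_real_derivative 2 * f x * (f x + 1) * d) (at x within S)"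
  unfolding pot_def by (auto intro!: derivative_eq_intros simp: algebra_simps power2_eq_square)

lemma continuous_on_pot [continuous_intros]:
  "continuous_on S f \<Longrightarrow> continuous_on S (\<lambda>x. pot (f x))"
  unfolding pot_def by (intro continuous_intros) auto

lemma level_curve_iff: "(n, b) \<in> level_curve C \<longleftrightarrow> 0 < n \<and> 0 < b \<and> b\<^sup>2 + pot n = C"
  by (auto simp: level_curve_def quadrant_def pot_def)

lemma level_curve_graph:
  assumes "0 < b" "0 < n" shows "(n, b) \<in> level_curve C \<longleftrightarrow> b = sqrt (C - pot n)"
proof
  assume "(n, b) \<in> level_curve C"
  then have "b\<^sup>2 = C - pot n" by (simp add: level_curve_iff)
  then show "b = sqrt (C - pot n)" using assms by (metis less_imp_le real_sqrt_unique)
next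
  assume b: "b = sqrt (C - pot n)"
  then have "0 < C - pot n" using assms(1) by simp
  then show "(n, b) \<in> level_curve C" using assms b by (simp add: level_curve_iff)
qed

lemma level_curve_anti:
  assumes "(n, b) \<in> level_curve C" "(n', b') \<in> level_curve C" "n < n'" shows "b' < b"
proof -
  have "pot n < pot n'" using assms by (intro pot_less) (auto simp: level_curve_iff)
  then have "b'\<^sup>2 < b\<^sup>2" using assms by (simp add: level_curve_iff)
  then show ?thesis using assms by (auto simp: level_curve_iff intro: power2_less_imp_less)
qed

text \<open>Both factors of \<open>\<sigma> = \<beta> (1 + 1 / \<nu>)\<close> decrease as \<open>\<nu>\<close> grows along a level curve.\<close>

lemma sigma_anti:
  assumes "(n, b) \<in> level_curve C" "(n', b') \<in> level_curve C" "n < n'"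
  shows "sigma n' b' < sigma n b"
proof -
  have pos: "0 < n" "0 < n'" "0 < b'" using assms by (auto simp: level_curve_iff)
  have "b' < b" using level_curve_anti[OF assms] .
  have "sigma n' b' = b' * (1 + 1 / n')" using pos by (simp add: sigma_def field_simps)
  also have "\<dots> < b * (1 + 1 / n)"
    using pos \<open>b' < b\<close> assms(3) by (intro mult_strict_mono) (auto simp: field_simps)
  also have "\<dots> = sigma n b" using pos by (simp add: sigma_def field_simps)
  finally show ?thesis .
qed

lemma level_curve_snd_unique:
  assumes "(n, b) \<in> level_curve C" "(n', b') \<in> level_curve C" "n = n'"
  shows "b = b'"
  using assms level_curve_graph[of b n C] level_curve_graph[of b' n' C] by (auto simp: level_curve_iff)

text \<open>Substituting \<open>\<beta> = k \<nu> / (\<nu> + 1)\<close> into the conserved quantity gives a continuous function of \<open>\<nu>\<close>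
  that is 0 at 0 and at least \<open>C\<close> at \<open>max 1 C\<close>, because \<open>\<nu>\<^sup>2 \<ge> C\<close> there.\<close>

lemma level_curve_meets_sigma_level:
  assumes "0 < C" "0 < k"
  obtains n b where "(n, b) \<in> level_curve C" "sigma n b = k"
proof -
  define f where "f x = pot x + (k * x / (x + 1))\<^sup>2" for x
  define u where "u = max 1 C"
  have "0 \<le> u" by (simp add: u_def)
  have "C \<le> u * u" using mult_mono[of 1 u C u] by (auto simp: u_def max_def)
  moreover have "0 \<le> u ^ 3" by (simp add: u_def)
  ultimately have "C \<le> f u" by (auto simp: f_def pot_def power2_eq_square intro!: add_increasing2)
  moreover have "f 0 = 0" by (simp add: f_def pot_def)
  moreover have "continuous_on {0..u} f"
    unfolding f_def by (intro continuous_intros) auto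
  ultimately obtain n where n: "0 \<le> n" "n \<le> u" "f n = C"
    using IVT'[of f 0 C u] assms(1) \<open>0 \<le> u\<close> by auto
  have "n \<noteq> 0" using n \<open>f 0 = 0\<close> assms by auto
  then have "0 < n" using n by simp
  show ?thesis
  proof (rule that)
    show "(n, k * n / (n + 1)) \<in> level_curve C"
      using n \<open>0 < n\<close> assms by (simp add: level_curve_iff f_def add.commute)
    show "sigma n (k * n / (n + 1)) = k" using \<open>0 < n\<close> by (simp add: sigma_def)
  qed
qed

section \<open>Conservation law and uniqueness\<close>

lemma time_dom_infinity: "time_dom \<infinity> = {0..}" by (auto simp: time_dom_def)

lemma time_dom_downward_closed:
  assumes "t \<in> time_dom T" shows "{0..t} \<subseteq> time_dom T"
proof
  fix s assume "s \<in> {0..t}"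
  then show "s \<in> time_dom T" using assms by (cases T) (auto simp: time_dom_def)
qed

lemma sigma_pos: "0 < n \<Longrightarrow> 0 < b \<Longrightarrow> 0 < sigma n b" by (simp add: sigma_def)

lemma solution_iff_drift:
  assumes "V > 0"
  shows "solution \<alpha> V T \<nu> \<beta> \<longleftrightarrow> 0 < T \<and> (\<forall>t \<in> time_dom T. 0 < \<nu> t \<and> 0 < \<beta> t \<and>
    (\<beta> has_real_derivative - (drift \<alpha> (sigma (\<nu> t) (\<beta> t) / V) / \<beta> t)) (at t within time_dom T) \<and>
    (\<nu> has_real_derivative drift \<alpha> (sigma (\<nu> t) (\<beta> t) / V) / (\<nu> t * (\<nu> t + 1))) (at t within time_dom T))"
proof -
  have "(\<nu> t, \<beta> t) \<in> quadrant \<longleftrightarrow> 0 < \<nu> t \<and> 0 < \<beta> t" for t by (simp add: quadrant_def)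
  moreover have "- E_dK_dbeta \<alpha> V (\<nu> t) (\<beta> t) = - (drift \<alpha> (sigma (\<nu> t) (\<beta> t) / V) / \<beta> t)"
    "- E_dK_dnu \<alpha> V (\<nu> t) (\<beta> t) = drift \<alpha> (sigma (\<nu> t) (\<beta> t) / V) / (\<nu> t * (\<nu> t + 1))"
    if "0 < \<nu> t" "0 < \<beta> t" for t
    using E_dK_dbeta_drift[OF assms sigma_pos[OF that]] E_dK_dnu_drift[OF assms sigma_pos[OF that]] by simp_all
  ultimately show ?thesis unfolding solution_def by metis
qed

lemma solution_pot_deriv:
  assumes "V > 0" "solution \<alpha> V T \<nu> \<beta>" "t \<in> time_dom T"
  shows "((\<lambda>t. pot (\<nu> t)) has_real_derivative 2 * drift \<alpha> (sigma (\<nu> t) (\<beta> t) / V)) (at t within time_dom T)"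
proof -
  have "0 < \<nu> t" using assms solution_iff_drift by blast
  moreover have "(\<nu> has_real_derivative drift \<alpha> (sigma (\<nu> t) (\<beta> t) / V) / (\<nu> t * (\<nu> t + 1))) (at t within time_dom T)"
    using assms solution_iff_drift by blast
  ultimately show ?thesis using DERIV_pot by fastforce
qed

text \<open>With \<open>d\<close> for the drift at the current point, \<open>\<beta>\<^sup>2\<close> has derivative \<open>- 2 d\<close> and \<open>pot \<nu>\<close> has
  derivative \<open>2 d\<close>.\<close>

lemma solution_on_level_curve:
  assumes V: "V > 0" and sol: "solution \<alpha> V T \<nu> \<beta>"
  defines "C \<equiv> (\<beta> 0)\<^sup>2 + pot (\<nu> 0)"
  shows "0 < C" "\<forall>t \<in> time_dom T. (\<nu> t, \<beta> t) \<in> level_curve C"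
proof -
  have pos: "0 < \<nu> t" "0 < \<beta> t" if "t \<in> time_dom T" for t
    using that sol solution_iff_drift[OF V] by blast+
  have "convex (time_dom T)"
    unfolding is_interval_convex_1[symmetric] is_interval_1
  proof (intro ballI allI impI)
    fix r s x assume "r \<in> time_dom T" "s \<in> time_dom T" "r \<le> x \<and> x \<le> s"
    then have "x \<in> {0..s}" by (auto simp: time_dom_def)
    then show "x \<in> time_dom T" using time_dom_downward_closed[OF \<open>s \<in> time_dom T\<close>] by blast
  qed
  moreover have "((\<lambda>t. (\<beta> t)\<^sup>2 + pot (\<nu> t)) has_field_derivative 0) (at t within time_dom T)" if t: "t \<in> time_dom T" for t
  proof -
    have "(\<beta> has_real_derivative - (drift \<alpha> (sigma (\<nu> t) (\<beta> t) / V) / \<beta> t)) (at t within time_dom T)"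
      using sol t solution_iff_drift[OF V] by blast
    from DERIV_add[OF DERIV_power[OF this, of 2] solution_pot_deriv[OF V sol t]] pos[OF t] show ?thesis
      by simp
  qed
  ultimately have "\<exists>c. \<forall>t\<in>time_dom T. (\<beta> t)\<^sup>2 + pot (\<nu> t) = c"
    by (rule has_field_derivative_zero_constant)
  moreover have z: "0 \<in> time_dom T" using sol by (simp add: solution_def time_dom_def zero_ereal_def)
  ultimately show lc: "\<forall>t \<in> time_dom T. (\<nu> t, \<beta> t) \<in> level_curve C"
    using pos by (auto simp: level_curve_iff C_def)
  show "0 < C" using pos[OF z] pot_less[of 0 "\<nu> 0"] by (simp add: C_def pot_def add_pos_pos)
qed

text \<open>Monotonicity does the work. Two solutions with the same starting point share a level
  curve, and there a larger \<open>pot \<nu>\<close> comes with a smaller drift, so the squared difference \<open>D\<close> of the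
  two values of \<open>pot \<nu>\<close> is nonincreasing; it starts at 0.\<close>

lemma solution_unique:
  assumes V: "V > 0" and \<alpha>: "\<alpha> > 0" and sol: "solution \<alpha> V T \<nu> \<beta>" "solution \<alpha> V T \<nu>' \<beta>'"
    and init: "\<nu> 0 = \<nu>' 0" "\<beta> 0 = \<beta>' 0" and t: "t \<in> time_dom T"
  shows "\<nu> t = \<nu>' t \<and> \<beta> t = \<beta>' t"
proof -
  define C where "C = (\<beta> 0)\<^sup>2 + pot (\<nu> 0)"
  have lc: "(\<nu> s, \<beta> s) \<in> level_curve C" "(\<nu>' s, \<beta>' s) \<in> level_curve C" if "s \<in> time_dom T" for s
    using solution_on_level_curve(2)[OF V sol(1)] solution_on_level_curve(2)[OF V sol(2)] that
    by (auto simp: C_def init)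
  define G where "G s = drift \<alpha> (sigma (\<nu> s) (\<beta> s) / V)" for s
  define G' where "G' s = drift \<alpha> (sigma (\<nu>' s) (\<beta>' s) / V)" for s
  define D where "D s = (pot (\<nu> s) - pot (\<nu>' s))\<^sup>2" for s
  have der: "(D has_real_derivative 4 * ((pot (\<nu> s) - pot (\<nu>' s)) * (G s - G' s))) (at s within time_dom T)"
    if "s \<in> time_dom T" for s
    unfolding D_def G_def G'_def
    using DERIV_power[OF DERIV_diff[OF solution_pot_deriv[OF V sol(1) that] solution_pot_deriv[OF V sol(2) that]], of 2]
    by (simp add: algebra_simps)
  have opp: "(pot n - pot n') * (drift \<alpha> (sigma n b / V) - drift \<alpha> (sigma n' b' / V)) \<le> 0"
    if "(n, b) \<in> level_curve C" "(n', b') \<in> level_curve C" "n < n'" for n b n' b'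
  proof -
    have pos: "0 < n" "0 < n'" "0 < b" "0 < b'" using that by (auto simp: level_curve_iff)
    have "pot n < pot n'" using that(3) pos by (intro pot_less) auto
    moreover have "drift \<alpha> (sigma n' b' / V) < drift \<alpha> (sigma n b / V)"
      using sigma_anti[OF that] V \<alpha> pos
      by (intro drift_strict_mono) (auto simp: sigma_pos divide_strict_right_mono)
    ultimately show ?thesis by (intro mult_nonpos_nonneg) auto
  qed
  have nonpos: "(pot (\<nu> s) - pot (\<nu>' s)) * (G s - G' s) \<le> 0" if "s \<in> time_dom T" for s
  proof (cases "\<nu> s" "\<nu>' s" rule: linorder_cases)
    case less
    then show ?thesis using opp[OF lc[OF that]] by (simp add: G_def G'_def)
  next
    case greater
    then show ?thesis using opp[OF lc(2)[OF that] lc(1)[OF that]] by (simp add: G_def G'_def algebra_simps)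
  qed auto
  have t0: "0 \<le> t" using t by (simp add: time_dom_def)
  have "D t \<le> D 0"
  proof (rule DERIV_nonpos_imp_decreasing_open[OF t0])
    fix s assume s: "0 < s" "s < t"
    have sd: "s \<in> time_dom T" using s time_dom_downward_closed[OF t] by auto
    have "at s within time_dom T = at s"
      using s time_dom_downward_closed[OF t] by (intro at_within_interior) (auto simp: interior_def intro!: exI[of _ "{0<..<t}"])
    then have "(D has_real_derivative 4 * ((pot (\<nu> s) - pot (\<nu>' s)) * (G s - G' s))) (at s)"
      using der[OF sd] by simp
    moreover have "4 * ((pot (\<nu> s) - pot (\<nu>' s)) * (G s - G' s)) \<le> 0" using nonpos[OF sd] by linarith
    ultimately show "\<exists>y. (D has_real_derivative y) (at s) \<and> y \<le> 0" by blast
  next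
    have "continuous_on (time_dom T) D"
      using der by (rule DERIV_continuous_on)
    then show "continuous_on {0..t} D" using time_dom_downward_closed[OF t] by (rule continuous_on_subset)
  qed
  then have "pot (\<nu> t) = pot (\<nu>' t)" by (simp add: D_def init)
  moreover have "0 < \<nu> t" "0 < \<nu>' t" using lc[OF t] by (auto simp: level_curve_iff)
  ultimately have "\<nu> t = \<nu>' t"
    using pot_less[of "\<nu> t" "\<nu>' t"] pot_less[of "\<nu>' t" "\<nu> t"] by (cases "\<nu> t" "\<nu>' t" rule: linorder_cases) auto
  then show ?thesis using level_curve_snd_unique[OF lc[OF t]] by simp
qed

section \<open>Global solutions\<close>

text \<open>The velocity of \<open>\<nu>\<close> after \<open>\<beta>\<close> has been eliminated by means of the level curve.\<close>

definition speed :: "real \<Rightarrow> real \<Rightarrow> real \<Rightarrow> real \<Rightarrow> real" where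
  "speed \<alpha> V C x = drift \<alpha> (sigma x (sqrt (C - pot x)) / V) / (x * (x + 1))"

lemma continuous_on_speed:
  assumes "V > 0" shows "continuous_on {x. 0 < x \<and> pot x < C} (speed \<alpha> V C)"
  unfolding speed_def sigma_def using assms
  by (intro continuous_intros continuous_on_compose2[OF continuous_on_drift]) auto

lemma DERIV_sqrt_pot:
  assumes "pot x < C"
  shows "((\<lambda>x. sqrt (C - pot x)) has_real_derivative - (x * (x + 1)) / sqrt (C - pot x)) (at x)"
  using assms by (auto intro!: derivative_eq_intros DERIV_pot[OF DERIV_ident] simp: field_simps)

text \<open>At an equilibrium the drift vanishes, so it is bounded by a multiple of the change of \<open>\<sigma>\<close>, which in
  turn is differentiable in \<open>\<nu>\<close>. This is what keeps solutions from reaching the equilibrium in finite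
  time.\<close>

lemma speed_lipschitz:
  assumes V: "V > 0" and \<alpha>: "\<alpha> > 0" and n: "0 < n" "pot n < C" and z: "drift \<alpha> (sigma n (sqrt (C - pot n)) / V) = 0"
  obtains L where "\<forall>\<^sub>F x in at n. \<bar>speed \<alpha> V C x\<bar> \<le> L * \<bar>x - n\<bar>"
proof -
  define s where "s x = sigma x (sqrt (C - pot x)) / V" for x
  define S where "S = (2 * \<alpha> + 1) / (2 * s n)"
  have sn: "0 < s n" using n V by (simp add: s_def sigma_pos)
  have "\<exists>D. (s has_real_derivative D) (at n)"
    unfolding s_def sigma_def using n V
    by (intro exI) (rule derivative_intros DERIV_sqrt_pot | simp)+
  then obtain D where D: "(s has_real_derivative D) (at n)" by blast
  \<comment> \<open>The Lipschitz bound for the mean shows that the speed is at most \<open>q x * \<bar>x - n\<bar>\<close>, and \<open>q\<close> has a finite limit at \<open>n\<close>.\<close>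
  define q where "q x = S * \<bar>(s x - s n) / (x - n)\<bar> / (x * (x + 1))" for x
  define L where "L = S * \<bar>D\<bar> / (n * (n + 1)) + 1"
  have "(q \<longlongrightarrow> S * \<bar>D\<bar> / (n * (n + 1))) (at n)"
    unfolding q_def using D n by (intro tendsto_intros) (auto simp: has_field_derivative_iff)
  then have "\<forall>\<^sub>F x in at n. q x < L" by (rule order_tendstoD) (simp add: L_def)
  moreover have "isCont s n" using D by (rule DERIV_isCont)
  then have "\<forall>\<^sub>F x in at n. 0 < s x" using sn by (intro order_tendstoD) (auto simp: isCont_def)
  moreover have "\<forall>\<^sub>F x in at n. 0 < x" using n by (intro order_tendstoD(1)[OF tendsto_ident_at]) auto
  moreover have "\<forall>\<^sub>F x in at n. x \<noteq> n" by (simp add: eventually_at_filter)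
  ultimately have "\<forall>\<^sub>F x in at n. \<bar>speed \<alpha> V C x\<bar> \<le> L * \<bar>x - n\<bar>"
  proof eventually_elim
    case (elim x)
    have "drift \<alpha> (s x) = (2 * \<alpha> + 1) * (mean_ratio (s x) - mean_ratio (s n))"
      using z by (simp add: drift_def s_def algebra_simps)
    then have "\<bar>drift \<alpha> (s x)\<bar> = (2 * \<alpha> + 1) * \<bar>mean_ratio (s x) - mean_ratio (s n)\<bar>" using \<alpha> by (simp add: abs_mult)
    also have "\<dots> \<le> (2 * \<alpha> + 1) * (\<bar>s x - s n\<bar> / (2 * s n))"
      using mean_ratio_lipschitz[OF sn elim(2)] \<alpha> by (intro mult_left_mono) auto
    also have "\<dots> = S * \<bar>s x - s n\<bar>" by (simp add: S_def)
    finally have "\<bar>speed \<alpha> V C x\<bar> \<le> S * \<bar>s x - s n\<bar> / (x * (x + 1))"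
      using elim unfolding speed_def s_def[symmetric] by (simp add: divide_right_mono)
    also have "\<dots> = q x * \<bar>x - n\<bar>" using elim by (simp add: q_def)
    also have "\<dots> \<le> L * \<bar>x - n\<bar>" using elim by (intro mult_right_mono) auto
    finally show ?case .
  qed
  then show ?thesis by (rule that)
qed

lemma solution_of_speed:
  assumes V: "V > 0"
    and x: "\<And>t. 0 \<le> t \<Longrightarrow> 0 < x t \<and> pot (x t) < C"
      "\<And>t. 0 \<le> t \<Longrightarrow> (x has_real_derivative speed \<alpha> V C (x t)) (at t)"
  shows "solution \<alpha> V \<infinity> x (\<lambda>t. sqrt (C - pot (x t)))"
  unfolding solution_iff_drift[OF V] time_dom_infinity
proof (intro conjI ballI)
  fix t :: real assume "t \<in> {0..}"
  then have t: "0 \<le> t" by simp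
  show "0 < x t" "0 < sqrt (C - pot (x t))" using x(1)[OF t] by auto
  show "(x has_real_derivative drift \<alpha> (sigma (x t) (sqrt (C - pot (x t))) / V) / (x t * (x t + 1))) (at t within {0..})"
    using x(2)[OF t] by (auto simp: speed_def intro: has_field_derivative_at_within)
  have "((\<lambda>t. sqrt (C - pot (x t))) has_real_derivative - (x t * (x t + 1)) / sqrt (C - pot (x t)) * speed \<alpha> V C (x t)) (at t)"
    using DERIV_chain2[OF DERIV_sqrt_pot x(2)[OF t]] x(1)[OF t] by blast
  moreover have "- (x t * (x t + 1)) / sqrt (C - pot (x t)) * speed \<alpha> V C (x t)
      = - (drift \<alpha> (sigma (x t) (sqrt (C - pot (x t))) / V) / sqrt (C - pot (x t)))"
    using x(1)[OF t] by (simp add: speed_def)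
  ultimately show "((\<lambda>t. sqrt (C - pot (x t))) has_real_derivative
      - (drift \<alpha> (sigma (x t) (sqrt (C - pot (x t))) / V) / sqrt (C - pot (x t)))) (at t within {0..})"
    by (auto intro: has_field_derivative_at_within)
qed simp

text \<open>Below the curve of equilibria \<open>\<sigma>\<close> is too small, hence \<open>\<nu>\<close> lies to the right of its equilibrium
  value \<open>\<nu>\<^sub>*\<close> on the level curve and the drift is negative up to \<open>\<nu>\<^sub>*\<close>; above the curve it is the other
  way round. In either case the scalar flow carries \<open>\<nu>\<close> monotonically to \<open>\<nu>\<^sub>*\<close>, and \<open>\<beta>\<close> follows in the
  opposite direction.\<close>

lemma global_solution:
  assumes V: "V > 0" and \<alpha>: "\<alpha> > 0" and p: "(n0, b0) \<in> level_curve C"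
  obtains \<nu> \<beta> ns bs where "solution \<alpha> V \<infinity> \<nu> \<beta>" "\<nu> 0 = n0" "\<beta> 0 = b0"
    "level_curve C \<inter> eq_curve \<alpha> V = {(ns, bs)}" "(\<nu> \<longlongrightarrow> ns) at_top" "(\<beta> \<longlongrightarrow> bs) at_top"
    "below_curve \<alpha> V (n0, b0) \<Longrightarrow> strict_antimono_on {0..} \<nu> \<and> strict_mono_on {0..} \<beta>"
    "above_curve \<alpha> V (n0, b0) \<Longrightarrow> strict_mono_on {0..} \<nu> \<and> strict_antimono_on {0..} \<beta>"
proof -
  obtain xs where xs: "0 < xs" "drift \<alpha> xs = 0" "A \<alpha> = \<alpha> - xs" using drift_root_A[OF \<alpha>] .
  have pos: "0 < n0" "0 < b0" and b0: "b0 = sqrt (C - pot n0)" and "pot n0 < C"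
    using p level_curve_graph[of b0 n0 C] by (auto simp: level_curve_iff)
  have "0 < C" using p pot_less[of 0 n0] by (auto simp: level_curve_iff pot_def add_pos_pos)
  then obtain ns bs where s: "(ns, bs) \<in> level_curve C" "sigma ns bs = xs * V"
    using level_curve_meets_sigma_level[of C "xs * V"] V xs by auto
  have spos: "0 < ns" "0 < bs" and bs: "bs = sqrt (C - pot ns)" and "pot ns < C"
    using s(1) level_curve_graph[of bs ns C] by (auto simp: level_curve_iff)
  have eq: "level_curve C \<inter> eq_curve \<alpha> V = {(ns, bs)}"
  proof -
    have "(ns, bs) \<in> eq_curve \<alpha> V" using s spos xs by (simp add: eq_curve_def sigma_def)
    moreover have "(n, b) = (ns, bs)" if "(n, b) \<in> level_curve C" "(n, b) \<in> eq_curve \<alpha> V" for n b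
    proof -
      have "sigma n b = sigma ns bs" using that s xs by (simp add: eq_curve_def sigma_def)
      then have "n = ns"
        using sigma_anti[OF that(1) s(1)] sigma_anti[OF s(1) that(1)] by (cases n ns rule: linorder_cases) auto
      then show ?thesis using level_curve_snd_unique[OF that(1) s(1)] by simp
    qed
    ultimately have "q \<in> level_curve C \<inter> eq_curve \<alpha> V \<longleftrightarrow> q = (ns, bs)" for q
      using s(1) by (metis Int_iff surj_pair)
    then show ?thesis by blast
  qed
  have dom: "0 < x \<and> pot x < C" if "min n0 ns \<le> x" "x \<le> max n0 ns" for x
  proof -
    have "0 < x" using that(1) pos spos by linarith
    moreover have "pot x \<le> pot (max n0 ns)" using that(2) \<open>0 < x\<close> by (intro pot_le) auto
    moreover have "pot (max n0 ns) < C" using \<open>pot n0 < C\<close> \<open>pot ns < C\<close> by (simp add: max_def)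
    ultimately show ?thesis by simp
  qed
  have on: "(x, sqrt (C - pot x)) \<in> level_curve C" if "min n0 ns \<le> x" "x \<le> max n0 ns" for x
    using dom[OF that] by (simp add: level_curve_iff)
  have speed_pos: "0 < speed \<alpha> V C x" if "n0 \<le> x" "x < ns" for x
  proof -
    have "xs * V < sigma x (sqrt (C - pot x))" using sigma_anti[OF on s(1)] that s(2) by auto
    then have "xs < sigma x (sqrt (C - pot x)) / V" using V by (simp add: field_simps)
    then have "0 < drift \<alpha> (sigma x (sqrt (C - pot x)) / V)" using drift_strict_mono[OF \<alpha> xs(1)] xs(2) by simp
    then show ?thesis using that pos by (simp add: speed_def)
  qed
  have speed_neg: "speed \<alpha> V C x < 0" if "ns < x" "x \<le> n0" for x
  proof -
    have "sigma x (sqrt (C - pot x)) < xs * V" using sigma_anti[OF s(1) on] that s(2) by auto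
    then have "sigma x (sqrt (C - pot x)) / V < xs" using V by (simp add: field_simps)
    moreover have "0 < sigma x (sqrt (C - pot x)) / V" using V dom[of x] that by (auto intro!: sigma_pos divide_pos_pos)
    ultimately have "drift \<alpha> (sigma x (sqrt (C - pot x)) / V) < 0" using drift_strict_mono[OF \<alpha>] xs(2) by metis
    then show ?thesis using that spos by (simp add: speed_def divide_neg_pos)
  qed
  have cont: "continuous_on {min n0 ns..max n0 ns} (speed \<alpha> V C)"
    by (rule continuous_on_subset[OF continuous_on_speed[OF V]]) (use dom in auto)
  have sz: "drift \<alpha> (sigma ns (sqrt (C - pot ns)) / V) = 0" using s(2) bs xs(2) V by simp
  obtain L where L: "\<forall>\<^sub>F x in at ns. \<bar>speed \<alpha> V C x\<bar> \<le> L * \<bar>x - ns\<bar>"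
    using speed_lipschitz[OF V \<alpha> spos(1) \<open>pot ns < C\<close> sz] .
  have "\<alpha> - A \<alpha> = xs" using xs(3) by simp
  have curve: "b0 < (\<alpha> - A \<alpha>) * V * (n0 / (n0 + 1)) \<longleftrightarrow> sigma n0 b0 < sigma ns bs"
    "(\<alpha> - A \<alpha>) * V * (n0 / (n0 + 1)) < b0 \<longleftrightarrow> sigma ns bs < sigma n0 b0"
    unfolding \<open>\<alpha> - A \<alpha> = xs\<close> s(2) using pos by (auto simp: sigma_def field_simps)
  have same: "sigma n0 b0 = sigma ns bs" if "n0 = ns"
    using level_curve_snd_unique[OF p s(1) that] that by simp
  have below: "ns < n0" if "below_curve \<alpha> V (n0, b0)"
  proof -
    have "sigma n0 b0 < sigma ns bs" using that curve(1) by (simp add: below_curve_def)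
    then show ?thesis using sigma_anti[OF p s(1)] same by (metis less_asym less_irrefl linorder_cases)
  qed
  have above: "n0 < ns" if "above_curve \<alpha> V (n0, b0)"
  proof -
    have "sigma ns bs < sigma n0 b0" using that curve(2) by (simp add: above_curve_def)
    then show ?thesis using sigma_anti[OF s(1) p] same by (metis less_asym less_irrefl linorder_cases)
  qed
  obtain x where x0: "x 0 = n0"
    and x_dom: "\<And>t. 0 \<le> t \<Longrightarrow> min n0 ns \<le> x t \<and> x t \<le> max n0 ns"
    and x_der: "\<And>t. 0 \<le> t \<Longrightarrow> (x has_real_derivative speed \<alpha> V C (x t)) (at t)"
    and x_lim: "(x \<longlongrightarrow> ns) at_top"
    and x_up: "n0 < ns \<Longrightarrow> strict_mono_on {0..} x"
    and x_down: "ns < n0 \<Longrightarrow> strict_antimono_on {0..} x"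
  proof (cases n0 ns rule: linorder_cases)
    case less
    have "\<forall>\<^sub>F x in at_left ns. \<bar>speed \<alpha> V C x\<bar> \<le> L * \<bar>x - ns\<bar>"
      using L by (rule filter_leD[OF at_le, rotated]) auto
    moreover have "\<forall>\<^sub>F x in at_left ns. x < ns" by (simp add: eventually_at_filter)
    ultimately have lip: "\<forall>\<^sub>F x in at_left ns. speed \<alpha> V C x \<le> L * (ns - x)"
      by eventually_elim auto
    have cont': "continuous_on {n0..<ns} (speed \<alpha> V C)"
      using less by (intro continuous_on_subset[OF cont]) auto
    have pos': "0 < speed \<alpha> V C x" if "x \<in> {n0..<ns}" for x
      using speed_pos that by simp
    show ?thesis
    proof (rule scalar_flow_up[OF less cont' pos' lip])
      fix y assume y: "y 0 = n0" "\<And>t. 0 \<le> t \<Longrightarrow> y t \<in> {n0..<ns}"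
        "\<And>t. 0 \<le> t \<Longrightarrow> (y has_real_derivative speed \<alpha> V C (y t)) (at t)"
        "strict_mono_on {0..} y" "(y \<longlongrightarrow> ns) at_top"
      have "min n0 ns \<le> y t \<and> y t \<le> max n0 ns" if "0 \<le> t" for t
        using y(2)[OF that] less by simp
      then show ?thesis by (rule that[OF y(1) _ y(3,5)]) (use y(4) less in simp_all)
    qed
  next
    case equal
    show ?thesis
      by (rule that[of "\<lambda>_. n0"]) (use equal sz in \<open>auto simp: speed_def\<close>)
  next
    case greater
    have "\<forall>\<^sub>F x in at_right ns. \<bar>speed \<alpha> V C x\<bar> \<le> L * \<bar>x - ns\<bar>"
      using L by (rule filter_leD[OF at_le, rotated]) auto
    moreover have "\<forall>\<^sub>F x in at_right ns. ns < x" by (simp add: eventually_at_filter)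
    ultimately have lip: "\<forall>\<^sub>F x in at_right ns. - speed \<alpha> V C x \<le> L * (x - ns)"
      by eventually_elim auto
    have cont': "continuous_on {ns<..n0} (speed \<alpha> V C)"
      using greater by (intro continuous_on_subset[OF cont]) auto
    have neg': "speed \<alpha> V C x < 0" if "x \<in> {ns<..n0}" for x
      using speed_neg that by simp
    show ?thesis
    proof (rule scalar_flow_down[OF greater cont' neg' lip])
      fix y assume y: "y 0 = n0" "\<And>t. 0 \<le> t \<Longrightarrow> y t \<in> {ns<..n0}"
        "\<And>t. 0 \<le> t \<Longrightarrow> (y has_real_derivative speed \<alpha> V C (y t)) (at t)"
        "strict_antimono_on {0..} y" "(y \<longlongrightarrow> ns) at_top"
      have "min n0 ns \<le> y t \<and> y t \<le> max n0 ns" if "0 \<le> t" for t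
        using y(2)[OF that] greater by simp
      then show ?thesis by (rule that[OF y(1) _ y(3,5)]) (use y(4) greater in simp_all)
    qed
  qed
  define \<beta> where "\<beta> t = sqrt (C - pot (x t))" for t
  have sol: "solution \<alpha> V \<infinity> x \<beta>"
    unfolding \<beta>_def using x_dom dom x_der by (intro solution_of_speed[OF V]) auto
  have lc: "(x t, \<beta> t) \<in> level_curve C" if "0 \<le> t" for t
    using on x_dom[OF that] by (simp add: \<beta>_def)
  have \<beta>_lim: "(\<beta> \<longlongrightarrow> bs) at_top"
    unfolding \<beta>_def bs pot_def by (intro tendsto_intros x_lim) auto
  have \<beta>0: "\<beta> 0 = b0" by (simp add: \<beta>_def x0 b0)
  show ?thesis
  proof (rule that[OF sol x0 \<beta>0 eq x_lim \<beta>_lim])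
    assume "below_curve \<alpha> V (n0, b0)"
    then have "strict_antimono_on {0..} x" by (rule x_down[OF below])
    moreover from this have "strict_mono_on {0..} \<beta>"
      using level_curve_anti[OF lc lc] by (simp add: monotone_on_def)
    ultimately show "strict_antimono_on {0..} x \<and> strict_mono_on {0..} \<beta>" by simp
  next
    assume "above_curve \<alpha> V (n0, b0)"
    then have "strict_mono_on {0..} x" by (rule x_up[OF above])
    moreover from this have "strict_antimono_on {0..} \<beta>"
      using level_curve_anti[OF lc lc] by (simp add: monotone_on_def)
    ultimately show "strict_mono_on {0..} x \<and> strict_antimono_on {0..} \<beta>" by simp
  qed
qed

section \<open>Tangent lines and orthogonality\<close>

text \<open>A differentiable path in the graph has \<open>snd \<circ> \<gamma> = h \<circ> fst \<circ> \<gamma>\<close> near 0, and the chain rule fixes the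
  slope of its velocity; conversely \<open>s \<mapsto> (x\<^sub>0 + c s, h (x\<^sub>0 + c s))\<close> has velocity \<open>c (1, d)\<close>. Only the part
  of \<open>S\<close> near the point matters, whence the neighbourhood \<open>N\<close>.\<close>

lemma tangent_space_graph:
  fixes h :: "real \<Rightarrow> real"
  assumes N: "open N" "(x0, h x0) \<in> N"
    and graph: "\<And>x y. (x, y) \<in> N \<Longrightarrow> (x, y) \<in> S \<longleftrightarrow> y = h x"
    and h: "(h has_real_derivative d) (at x0)"
  shows "tangent_space S (x0, h x0) = span {(1, d)}"
proof -
  have ev_N: "\<forall>\<^sub>F s in nhds 0. \<gamma> s \<in> N"
    if "(\<gamma> has_vector_derivative v) (at 0)" "\<gamma> 0 = (x0, h x0)" for \<gamma> :: "real \<Rightarrow> real \<times> real" and v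
  proof -
    have "isCont \<gamma> 0" using that(1) by (rule has_vector_derivative_continuous)
    then have "\<forall>\<^sub>F s in at 0. \<gamma> s \<in> N" using N that(2) by (auto simp: isCont_def intro: topological_tendstoD)
    then show ?thesis using N that(2) by (simp add: eventually_nhds_conv_at)
  qed
  have "v \<in> span {(1, d)}" if v: "v \<in> tangent_space S (x0, h x0)" for v
  proof -
    obtain \<gamma> where \<gamma>: "\<gamma> 0 = (x0, h x0)" "\<forall>\<^sub>F s in nhds 0. \<gamma> s \<in> S" "(\<gamma> has_vector_derivative v) (at 0)"
      using v unfolding tangent_space_def by blast
    have f: "((\<lambda>s. fst (\<gamma> s)) has_real_derivative fst v) (at 0)"
      and g: "((\<lambda>s. snd (\<gamma> s)) has_real_derivative snd v) (at 0)"
      using bounded_linear.has_vector_derivative[OF bounded_linear_fst \<gamma>(3)]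
        bounded_linear.has_vector_derivative[OF bounded_linear_snd \<gamma>(3)]
      by (simp_all add: has_real_derivative_iff_has_vector_derivative)
    have "((\<lambda>s. h (fst (\<gamma> s))) has_real_derivative d * fst v) (at 0)"
      using f h \<gamma>(1) by (intro DERIV_chain2[of h]) auto
    moreover have "\<forall>\<^sub>F s in nhds 0. snd (\<gamma> s) = h (fst (\<gamma> s))"
      using \<gamma>(2) ev_N[OF \<gamma>(3,1)] by eventually_elim (metis graph prod.collapse)
    ultimately have "((\<lambda>s. snd (\<gamma> s)) has_real_derivative d * fst v) (at 0)"
      by (rule iffD2[OF DERIV_cong_ev[OF refl _ refl], rotated])
    with g have "snd v = d * fst v" by (rule DERIV_unique)
    then have "v = fst v *\<^sub>R (1, d)" by (simp add: prod_eq_iff)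
    then show ?thesis by (metis span_base span_scale singletonI)
  qed
  moreover have "v \<in> tangent_space S (x0, h x0)" if v: "v \<in> span {(1, d)}" for v
  proof -
    obtain c where c: "v = c *\<^sub>R (1, d)" using v unfolding span_singleton by blast
    define \<gamma> where "\<gamma> s = (x0 + s * c, h (x0 + s * c))" for s
    have "((\<lambda>s. h (x0 + s * c)) has_real_derivative d * c) (at 0)"
      using h by (intro DERIV_chain2[of h]) (auto intro!: derivative_eq_intros)
    then have der: "(\<gamma> has_vector_derivative v) (at 0)"
      unfolding \<gamma>_def c scaleR_Pair
      by (intro has_vector_derivative_Pair)
        (auto simp: has_real_derivative_iff_has_vector_derivative[symmetric] mult.commute intro!: derivative_eq_intros)
    have "\<forall>\<^sub>F s in nhds 0. \<gamma> s \<in> S"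
      using ev_N[OF der] by (rule eventually_mono) (auto simp: \<gamma>_def graph)
    then show ?thesis unfolding tangent_space_def using der by (auto simp: \<gamma>_def intro!: exI[of _ \<gamma>])
  qed
  ultimately show ?thesis by blast
qed

lemma open_quadrant: "open quadrant"
proof -
  have "quadrant = {0<..} \<times> {0<..}" by (auto simp: quadrant_def)
  then show ?thesis by (metis open_Times open_greaterThan)
qed

text \<open>In the quadrant both curves are graphs over the \<open>\<nu>\<close>-axis. The slope \<open>k / (\<nu> + 1)\<^sup>2\<close> of the curve of
  equilibria equals \<open>\<beta> / (\<nu> (\<nu> + 1))\<close> at a point with \<open>\<beta> (\<nu> + 1) / \<nu> = k\<close>.\<close>

lemma curves_orthogonal:
  assumes p: "p \<in> level_curve C \<inter> eq_curve a W"
  shows "orthogonal_at (level_curve C) (eq_curve a W) p"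
proof -
  obtain n b where nb: "p = (n, b)" by (cases p)
  have pos: "0 < n" "0 < b" and b: "b = sqrt (C - pot n)" and "pot n < C"
    using p level_curve_graph[of b n C] by (auto simp: nb level_curve_iff)
  define k where "k = (a - A a) * W"
  have k: "b * (n + 1) / n = k" using p by (simp add: nb eq_curve_def k_def)
  then have b': "b = k * n / (n + 1)" using pos by (auto simp: field_simps)
  have q: "(n, b) \<in> quadrant" using pos by (simp add: quadrant_def)
  have "tangent_space (level_curve C) (n, sqrt (C - pot n)) = span {(1, - (n * (n + 1)) / sqrt (C - pot n))}"
    using q b by (intro tangent_space_graph[OF open_quadrant] DERIV_sqrt_pot \<open>pot n < C\<close>)
      (auto simp: quadrant_def level_curve_graph)
  moreover have "tangent_space (eq_curve a W) (n, k * n / (n + 1)) = span {(1, k / (n + 1)\<^sup>2)}"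
  proof (intro tangent_space_graph[OF open_quadrant, where h = "\<lambda>x. k * x / (x + 1)"])
    show "((\<lambda>x. k * x / (x + 1)) has_real_derivative k / (n + 1)\<^sup>2) (at n)"
      using pos by (auto intro!: derivative_eq_intros simp: power2_eq_square algebra_simps)
    show "(x, y) \<in> eq_curve a W \<longleftrightarrow> y = k * x / (x + 1)" if "(x, y) \<in> quadrant" for x y
    proof -
      have "(x, y) \<in> eq_curve a W \<longleftrightarrow> y * (x + 1) / x = k" "0 < x"
        using that by (auto simp: quadrant_def eq_curve_def k_def)
      then show ?thesis by (auto simp: field_simps)
    qed
  qed (use q b' in simp)
  moreover have "orthogonal (1 :: real, - (n * (n + 1)) / b) (1, k / (n + 1)\<^sup>2)"
    using pos by (simp add: orthogonal_def inner_prod_def k[symmetric] power2_eq_square)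
  ultimately show ?thesis
    unfolding orthogonal_at_def nb b[symmetric] b'[symmetric]
    by (intro exI[of _ "(1, - (n * (n + 1)) / b)"] exI[of _ "(1, k / (n + 1)\<^sup>2)"]) (auto simp: zero_prod_def)
qed

section \<open>Equilibria and trajectories\<close>

lemma trajectory_if_global: "solution \<alpha> V \<infinity> \<nu> \<beta> \<Longrightarrow> trajectory \<alpha> V \<infinity> \<nu> \<beta>"
  by (auto simp: trajectory_def)

lemma eq_curve_equilibrium:
  assumes V: "V > 0" and \<alpha>: "\<alpha> > 0" and p: "p \<in> eq_curve \<alpha> V"
  shows "equilibrium \<alpha> V p"
proof -
  obtain xs where xs: "0 < xs" "drift \<alpha> xs = 0" "A \<alpha> = \<alpha> - xs" using drift_root_A[OF \<alpha>] .
  obtain n b where nb: "p = (n, b)" by (cases p)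
  have n: "0 < n" and s: "sigma n b = xs * V" using p xs by (auto simp: nb eq_curve_def sigma_def)
  have "0 < sigma n b" using s xs V by simp
  then have b: "0 < b" using n by (simp add: sigma_def zero_less_divide_iff zero_less_mult_iff)
  show ?thesis
    using n b s xs V E_dK_dbeta_drift[OF V sigma_pos[OF n b]] E_dK_dnu_drift[OF V sigma_pos[OF n b]]
    by (simp add: equilibrium_def nb quadrant_def)
qed

text \<open>Uniqueness identifies the trajectory on \<open>[0, T)\<close> with the global solution through its starting
  point. For finite \<open>T\<close> the latter would be a proper extension, which maximality excludes.\<close>

lemma trajectory_behaviour:
  assumes V: "V > 0" and \<alpha>: "\<alpha> > 0" and tr: "trajectory \<alpha> V T \<nu> \<beta>"
  defines "C \<equiv> (\<beta> 0)\<^sup>2 + pot (\<nu> 0)"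
  obtains ns bs where "T = \<infinity>" "level_curve C \<inter> eq_curve \<alpha> V = {(ns, bs)}"
    "(\<nu> \<longlongrightarrow> ns) at_top" "(\<beta> \<longlongrightarrow> bs) at_top"
    "below_curve \<alpha> V (\<nu> 0, \<beta> 0) \<Longrightarrow> strict_antimono_on {0..} \<nu> \<and> strict_mono_on {0..} \<beta>"
    "above_curve \<alpha> V (\<nu> 0, \<beta> 0) \<Longrightarrow> strict_mono_on {0..} \<nu> \<and> strict_antimono_on {0..} \<beta>"
proof -
  have sol: "solution \<alpha> V T \<nu> \<beta>" using tr by (simp add: trajectory_def)
  have "0 \<in> time_dom T" using sol by (simp add: solution_def time_dom_def zero_ereal_def)
  then have "(\<nu> 0, \<beta> 0) \<in> level_curve C"
    using solution_on_level_curve[OF V sol] by (simp add: C_def)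
  then obtain \<nu>' \<beta>' ns bs where g: "solution \<alpha> V \<infinity> \<nu>' \<beta>'" "\<nu>' 0 = \<nu> 0" "\<beta>' 0 = \<beta> 0"
    "level_curve C \<inter> eq_curve \<alpha> V = {(ns, bs)}" "(\<nu>' \<longlongrightarrow> ns) at_top" "(\<beta>' \<longlongrightarrow> bs) at_top"
    "below_curve \<alpha> V (\<nu> 0, \<beta> 0) \<Longrightarrow> strict_antimono_on {0..} \<nu>' \<and> strict_mono_on {0..} \<beta>'"
    "above_curve \<alpha> V (\<nu> 0, \<beta> 0) \<Longrightarrow> strict_mono_on {0..} \<nu>' \<and> strict_antimono_on {0..} \<beta>'"
    by (rule global_solution[OF V \<alpha>]) blast
  have sub: "time_dom T \<subseteq> time_dom \<infinity>" by (auto simp: time_dom_def)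
  have "solution \<alpha> V T \<nu>' \<beta>'"
    using g(1) sol sub unfolding solution_def by (meson has_field_derivative_subset subsetD)
  then have eq: "\<nu>' t = \<nu> t \<and> \<beta>' t = \<beta> t" if "t \<in> time_dom T" for t
    using solution_unique[OF V \<alpha> _ sol] g(2,3) that by blast
  have T: "T = \<infinity>"
    using tr g(1) eq unfolding trajectory_def by (metis ereal_less_eq(1))
  have eq': "\<nu>' t = \<nu> t" "\<beta>' t = \<beta> t" if "0 \<le> t" for t
    using eq that by (auto simp: T time_dom_infinity)
  have ev: "\<forall>\<^sub>F t in at_top. \<nu>' t = \<nu> t" "\<forall>\<^sub>F t in at_top. \<beta>' t = \<beta> t"
    using eq' by (auto intro: eventually_at_top_linorderI[of 0])
  show ?thesis
  proof (rule that[OF T g(4)])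
    show "(\<nu> \<longlongrightarrow> ns) at_top" "(\<beta> \<longlongrightarrow> bs) at_top"
      using g(5,6) tendsto_cong[OF ev(1)] tendsto_cong[OF ev(2)] by blast+
  qed (use g(7,8) eq' in \<open>auto simp: monotone_on_def\<close>)
qed

theorem theorem4p1:
  fixes V \<alpha> :: real
  assumes "V > 0" and "\<alpha> > 0"
  shows
    "((\<forall>p \<in> eq_curve \<alpha> V. equilibrium \<alpha> V p) \<and>
      (\<forall>p \<in> quadrant. \<exists>T \<nu> \<beta>. trajectory \<alpha> V T \<nu> \<beta> \<and> (\<nu> 0, \<beta> 0) = p) \<and>
      (\<forall>T \<nu> \<beta>. trajectory \<alpha> V T \<nu> \<beta> \<longrightarrow>
         T = \<infinity> \<and> ((\<lambda>t. infdist (\<nu> t, \<beta> t) (eq_curve \<alpha> V)) \<longlongrightarrow> 0) at_top))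
     \<and>
     (\<forall>T \<nu> \<beta>. trajectory \<alpha> V T \<nu> \<beta> \<longrightarrow>
        (\<exists>C > 0. (\<forall>t \<in> time_dom T. (\<nu> t, \<beta> t) \<in> level_curve C) \<and>
           (below_curve \<alpha> V (\<nu> 0, \<beta> 0) \<longrightarrow>
              (\<exists>\<nu>s \<beta>s. strict_antimono_on (time_dom T) \<nu> \<and> (\<nu> \<longlongrightarrow> \<nu>s) at_top \<and>
                 strict_mono_on (time_dom T) \<beta> \<and> (\<beta> \<longlongrightarrow> \<beta>s) at_top \<and>
                 level_curve C \<inter> eq_curve \<alpha> V = {(\<nu>s, \<beta>s)})) \<and>
           (above_curve \<alpha> V (\<nu> 0, \<beta> 0) \<longrightarrow>
              (\<exists>\<nu>s \<beta>s. strict_mono_on (time_dom T) \<nu> \<and> (\<nu> \<longlongrightarrow> \<nu>s) at_top \<and>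
                 strict_antimono_on (time_dom T) \<beta> \<and> (\<beta> \<longlongrightarrow> \<beta>s) at_top \<and>
                 level_curve C \<inter> eq_curve \<alpha> V = {(\<nu>s, \<beta>s)}))))
     \<and>
     (\<forall>C > 0. \<forall>a > 0. \<forall>W > 0. \<forall>p \<in> level_curve C \<inter> eq_curve a W.
        orthogonal_at (level_curve C) (eq_curve a W) p)"
proof (intro conjI ballI allI impI)
  show "equilibrium \<alpha> V p" if "p \<in> eq_curve \<alpha> V" for p
    using eq_curve_equilibrium[OF assms that] .
  show "\<exists>T \<nu> \<beta>. trajectory \<alpha> V T \<nu> \<beta> \<and> (\<nu> 0, \<beta> 0) = p" if "p \<in> quadrant" for p
  proof -
    obtain n b where nb: "p = (n, b)" by (cases p)
    have "(n, b) \<in> level_curve (b\<^sup>2 + pot n)" using that by (simp add: nb quadrant_def level_curve_iff)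
    from global_solution[OF assms this] obtain \<nu> \<beta> where "solution \<alpha> V \<infinity> \<nu> \<beta>" "\<nu> 0 = n" "\<beta> 0 = b"
      by metis
    then show ?thesis using nb trajectory_if_global by blast
  qed
next
  fix T \<nu> \<beta> assume tr: "trajectory \<alpha> V T \<nu> \<beta>"
  from trajectory_behaviour[OF assms tr] obtain ns bs where T: "T = \<infinity>"
    and eq: "level_curve ((\<beta> 0)\<^sup>2 + pot (\<nu> 0)) \<inter> eq_curve \<alpha> V = {(ns, bs)}"
    and lim: "(\<nu> \<longlongrightarrow> ns) at_top" "(\<beta> \<longlongrightarrow> bs) at_top"
    by metis
  show "T = \<infinity>" by (fact T)
  have on: "(ns, bs) \<in> eq_curve \<alpha> V" using eq by blast
  show "((\<lambda>t. infdist (\<nu> t, \<beta> t) (eq_curve \<alpha> V)) \<longlongrightarrow> 0) at_top"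
  proof (rule tendsto_sandwich[OF _ _ tendsto_const])
    show "((\<lambda>t. dist (\<nu> t, \<beta> t) (ns, bs)) \<longlongrightarrow> 0) at_top"
      by (rule tendsto_dist_iff[THEN iffD1, OF tendsto_Pair[OF lim]])
  qed (use on in \<open>auto intro!: always_eventually infdist_le infdist_nonneg\<close>)
next
  fix T \<nu> \<beta> assume tr: "trajectory \<alpha> V T \<nu> \<beta>"
  then have sol: "solution \<alpha> V T \<nu> \<beta>" by (simp add: trajectory_def)
  from trajectory_behaviour[OF assms tr] obtain ns bs where T: "T = \<infinity>"
    and eq: "level_curve ((\<beta> 0)\<^sup>2 + pot (\<nu> 0)) \<inter> eq_curve \<alpha> V = {(ns, bs)}"
    and lim: "(\<nu> \<longlongrightarrow> ns) at_top" "(\<beta> \<longlongrightarrow> bs) at_top"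
    and mono: "below_curve \<alpha> V (\<nu> 0, \<beta> 0) \<Longrightarrow> strict_antimono_on {0..} \<nu> \<and> strict_mono_on {0..} \<beta>"
      "above_curve \<alpha> V (\<nu> 0, \<beta> 0) \<Longrightarrow> strict_mono_on {0..} \<nu> \<and> strict_antimono_on {0..} \<beta>"
    by metis
  show "\<exists>C > 0. (\<forall>t \<in> time_dom T. (\<nu> t, \<beta> t) \<in> level_curve C) \<and>
           (below_curve \<alpha> V (\<nu> 0, \<beta> 0) \<longrightarrow>
              (\<exists>\<nu>s \<beta>s. strict_antimono_on (time_dom T) \<nu> \<and> (\<nu> \<longlongrightarrow> \<nu>s) at_top \<and>
                 strict_mono_on (time_dom T) \<beta> \<and> (\<beta> \<longlongrightarrow> \<beta>s) at_top \<and>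
                 level_curve C \<inter> eq_curve \<alpha> V = {(\<nu>s, \<beta>s)})) \<and>
           (above_curve \<alpha> V (\<nu> 0, \<beta> 0) \<longrightarrow>
              (\<exists>\<nu>s \<beta>s. strict_mono_on (time_dom T) \<nu> \<and> (\<nu> \<longlongrightarrow> \<nu>s) at_top \<and>
                 strict_antimono_on (time_dom T) \<beta> \<and> (\<beta> \<longlongrightarrow> \<beta>s) at_top \<and>
                 level_curve C \<inter> eq_curve \<alpha> V = {(\<nu>s, \<beta>s)}))"
  proof (rule exI[of _ "(\<beta> 0)\<^sup>2 + pot (\<nu> 0)"], intro conjI impI)
    show "0 < (\<beta> 0)\<^sup>2 + pot (\<nu> 0)" "\<forall>t \<in> time_dom T. (\<nu> t, \<beta> t) \<in> level_curve ((\<beta> 0)\<^sup>2 + pot (\<nu> 0))"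
      by (fact solution_on_level_curve[OF assms(1) sol])+
  next
    assume "below_curve \<alpha> V (\<nu> 0, \<beta> 0)"
    from mono(1)[OF this] eq lim show "\<exists>\<nu>s \<beta>s. strict_antimono_on (time_dom T) \<nu> \<and> (\<nu> \<longlongrightarrow> \<nu>s) at_top \<and>
        strict_mono_on (time_dom T) \<beta> \<and> (\<beta> \<longlongrightarrow> \<beta>s) at_top \<and>
        level_curve ((\<beta> 0)\<^sup>2 + pot (\<nu> 0)) \<inter> eq_curve \<alpha> V = {(\<nu>s, \<beta>s)}"
      unfolding T time_dom_infinity by blast
  next
    assume "above_curve \<alpha> V (\<nu> 0, \<beta> 0)"
    from mono(2)[OF this] eq lim show "\<exists>\<nu>s \<beta>s. strict_mono_on (time_dom T) \<nu> \<and> (\<nu> \<longlongrightarrow> \<nu>s) at_top \<and>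
        strict_antimono_on (time_dom T) \<beta> \<and> (\<beta> \<longlongrightarrow> \<beta>s) at_top \<and>
        level_curve ((\<beta> 0)\<^sup>2 + pot (\<nu> 0)) \<inter> eq_curve \<alpha> V = {(\<nu>s, \<beta>s)}"
      unfolding T time_dom_infinity by blast
  qed
next
  fix C a W p assume "p \<in> level_curve C \<inter> eq_curve a W"
  then show "orthogonal_at (level_curve C) (eq_curve a W) p" by (rule curves_orthogonal)
qed

end
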